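(* Let $K$ be a field, $S=K[x_1,\ldots,x_n]$, and let $I\subset S$ be a nonzero monomial ideal. Then the following hold: (a) For $k\ge 1$: if $I^k$ is of intersection type, then $I^{(\operatorname{reg}(I^k))}\subset I^k$. (b) If $I^k$ is of intersection type for all $k\gg0$, then $I^{(rk)}\subset I^k$ for all $k\gg0$, where $r=\rho(I)+1$. In particular, $r\leq\theta(I)+1$. Moreover, if in addition $I^k$ has a linear resolution for all $k\gg0$, then $r$ can be chosen to be $\theta(I)$, that is, $I^{(\theta(I)k)}\subset I^k$ for all $k\gg0$.
   Context: A monomial prime ideal is a prime ideal generated by a subset of the variables. A monomial ideal is of intersection type if it is an intersection of powers (with positive integer exponents; the empty intersection is $S$) of monomial prime ideals. Symbolic powers are defined as follows: let $Q_1,\ldots,Q_s$ be the uniquely determined primary components of $I$ corresponding to the minimal prime ideals of $I$; then $I^{(t)}=\bigcap_{i=1}^sQ_i^t$. $\operatorname{reg}$ denotes Castelnuovo–Mumford regularity. A graded ideal has a linear resolution if it is generated in a single degree $d$ and its regularity equals $d$. For a graded ideal $J$, $\theta(J)$ denotes the maximal degree of a generator in a minimal set of homogeneous generators of $J$. An ideal $J\subset I$ is a reduction of $I$ if $I^k=JI^{k-1}$ for some $k\geq2$; $\rho(I)$ denotes the minimum of $\theta(J)$ over all graded reductions $J$ of $I$. "For all $k\gg0$" means for all sufficiently large $k$. *)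

theory Defs
  imports
    "HOL-Algebra.Algebraic_Closure_Type"
    "HOL-Algebra.Ideal_Product"
    "HOL-Library.Poly_Mapping"
begin

text \<open>
  The polynomial ring \<open>K[x\<^sub>1, \<dots>, x\<^sub>n]\<close> is the type \<open>('n \<Rightarrow>\<^sub>0 nat) \<Rightarrow>\<^sub>0 'k\<close>, where the finite type \<open>'n\<close>
  indexes the variables and \<open>'n \<Rightarrow>\<^sub>0 nat\<close> is the type of exponent vectors. Ideals are those
  of \<^theory>\<open>HOL-Algebra.Ideal\<close> in the ring \<^const>\<open>ring_of_type_algebra\<close>, whose carrier is
  \<^const>\<open>UNIV\<close>. In particular an empty intersection of ideals is the whole ring.
\<close>

type_synonym ('n, 'k) mpoly = "('n \<Rightarrow>\<^sub>0 nat) \<Rightarrow>\<^sub>0 'k"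


section \<open>Ideals of a commutative ring\<close>

abbreviation is_ideal :: "'a::comm_ring_1 set \<Rightarrow> bool" where
  "is_ideal I \<equiv> ideal I ring_of_type_algebra"

abbreviation is_prime_ideal :: "'a::comm_ring_1 set \<Rightarrow> bool" where
  "is_prime_ideal P \<equiv> primeideal P ring_of_type_algebra"

abbreviation ideal_gen :: "'a::comm_ring_1 set \<Rightarrow> 'a set" where
  "ideal_gen A \<equiv> genideal ring_of_type_algebra A"

abbreviation ideal_mult :: "'a::comm_ring_1 set \<Rightarrow> 'a set \<Rightarrow> 'a set" where
  "ideal_mult I J \<equiv> ideal_prod ring_of_type_algebra I J"

text \<open>The zeroth power is the whole ring.\<close>

abbreviation ideal_power :: "'a::comm_ring_1 set \<Rightarrow> nat \<Rightarrow> 'a set" where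
  "ideal_power I k \<equiv> I [^]\<^bsub>ideals_set ring_of_type_algebra\<^esub> k"

definition minimal_prime_over :: "'a::comm_ring_1 set \<Rightarrow> 'a set \<Rightarrow> bool" where
  "minimal_prime_over I P \<longleftrightarrow> is_prime_ideal P \<and> I \<subseteq> P \<and>
     (\<forall>P'. is_prime_ideal P' \<and> I \<subseteq> P' \<and> P' \<subseteq> P \<longrightarrow> P' = P)"

definition primary_ideal :: "'a::comm_ring_1 set \<Rightarrow> bool" where
  "primary_ideal Q \<longleftrightarrow> is_ideal Q \<and> Q \<noteq> UNIV \<and>
     (\<forall>f g. f * g \<in> Q \<longrightarrow> f \<in> Q \<or> (\<exists>m. g ^ m \<in> Q))"

definition ideal_radical :: "'a::comm_ring_1 set \<Rightarrow> 'a set" where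
  "ideal_radical I = {f. \<exists>m. f ^ m \<in> I}"

definition irredundant_primary_decomposition :: "'a::comm_ring_1 set \<Rightarrow> 'a set set \<Rightarrow> bool" where
  "irredundant_primary_decomposition I \<Q> \<longleftrightarrow>
     finite \<Q> \<and> (\<forall>Q\<in>\<Q>. primary_ideal Q) \<and> I = \<Inter>\<Q> \<and>
     inj_on ideal_radical \<Q> \<and> (\<forall>Q\<in>\<Q>. \<not> \<Inter>(\<Q> - {Q}) \<subseteq> Q)"

text \<open>
  The primary components belonging to the minimal primes of \<open>I\<close>. By the second uniqueness
  theorem they are the same in every irredundant primary decomposition.
\<close>

definition minimal_primary_components :: "'a::comm_ring_1 set \<Rightarrow> 'a set set" where
  "minimal_primary_components I =
     {Q. \<exists>\<Q>. irredundant_primary_decomposition I \<Q> \<and> Q \<in> \<Q> \<and>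
             minimal_prime_over I (ideal_radical Q)}"

definition symbolic_power :: "'a::comm_ring_1 set \<Rightarrow> nat \<Rightarrow> 'a set" where
  "symbolic_power I t = (\<Inter>Q\<in>minimal_primary_components I. ideal_power Q t)"

definition is_reduction :: "'a::comm_ring_1 set \<Rightarrow> 'a set \<Rightarrow> bool" where
  "is_reduction J I \<longleftrightarrow> is_ideal J \<and> J \<subseteq> I \<and>
     (\<exists>k\<ge>2. ideal_power I k = ideal_mult J (ideal_power I (k - 1)))"


section \<open>Monomial ideals\<close>

definition monomial_ideal :: "('n::finite, 'k::field) mpoly set \<Rightarrow> bool" where
  "monomial_ideal I \<longleftrightarrow>
     (\<exists>M :: ('n \<Rightarrow>\<^sub>0 nat) set. I = ideal_gen ((\<lambda>m. Poly_Mapping.single m 1) ` M))"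

definition poly_var :: "'n \<Rightarrow> ('n::finite, 'k::field) mpoly" where
  "poly_var i = Poly_Mapping.single (Poly_Mapping.single i 1) 1"

definition monomial_prime_ideal :: "('n::finite, 'k::field) mpoly set \<Rightarrow> bool" where
  "monomial_prime_ideal P \<longleftrightarrow> is_prime_ideal P \<and> (\<exists>A. P = ideal_gen (poly_var ` A))"

definition intersection_type :: "('n::finite, 'k::field) mpoly set \<Rightarrow> bool" where
  "intersection_type I \<longleftrightarrow>
     (\<exists>\<F>. finite \<F> \<and> (\<forall>(P, d)\<in>\<F>. monomial_prime_ideal P \<and> d \<ge> 1) \<and>
          I = (\<Inter>(P, d)\<in>\<F>. ideal_power P d))"


section \<open>Graded ideals\<close>

definition mono_degree :: "('n::finite \<Rightarrow>\<^sub>0 nat) \<Rightarrow> nat" where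
  "mono_degree m = (\<Sum>i\<in>UNIV. Poly_Mapping.lookup m i)"

text \<open>The zero polynomial is homogeneous of every degree.\<close>

definition homogeneous :: "nat \<Rightarrow> ('n::finite, 'k::field) mpoly \<Rightarrow> bool" where
  "homogeneous d f \<longleftrightarrow> (\<forall>m\<in>Poly_Mapping.keys f. mono_degree m = d)"

definition poly_degree :: "('n::finite, 'k::field) mpoly \<Rightarrow> nat" where
  "poly_degree f = Max (mono_degree ` Poly_Mapping.keys f)"

definition graded_ideal :: "('n::finite, 'k::field) mpoly set \<Rightarrow> bool" where
  "graded_ideal J \<longleftrightarrow> (\<exists>G. (\<forall>g\<in>G. \<exists>d. homogeneous d g) \<and> J = ideal_gen G)"

text \<open>Minimality rules out the generator \<open>0\<close>.\<close>

definition minimal_homogeneous_generators ::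
    "('n::finite, 'k::field) mpoly set \<Rightarrow> ('n, 'k) mpoly set \<Rightarrow> bool" where
  "minimal_homogeneous_generators J G \<longleftrightarrow>
     finite G \<and> (\<forall>g\<in>G. \<exists>d. homogeneous d g) \<and> J = ideal_gen G \<and> (\<forall>H. H \<subset> G \<longrightarrow> ideal_gen H \<noteq> J)"

text \<open>
  By graded Nakayama the degrees do not depend on the chosen minimal set of generators. The
  value is unspecified for the zero ideal.
\<close>

definition theta :: "('n::finite, 'k::field) mpoly set \<Rightarrow> nat" where
  "theta J = Max (poly_degree ` (SOME G. minimal_homogeneous_generators J G))"

definition rho :: "('n::finite, 'k::field) mpoly set \<Rightarrow> nat" where
  "rho I = (LEAST d. \<exists>J. graded_ideal J \<and> is_reduction J I \<and> theta J = d)"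


section \<open>Castelnuovo--Mumford regularity\<close>

text \<open>
  The data of a complex \<open>\<dots> \<rightarrow> F\<^sub>1 \<rightarrow> F\<^sub>0 \<rightarrow> J\<close>, where \<open>F\<^sub>i\<close> is the direct sum of the modules
  \<open>S(- shift i p)\<close> for \<open>p < rank i\<close>, with basis \<open>e\<^sub>i\<^sub>p\<close> of degree \<open>shift i p\<close>. The augmentation maps
  \<open>e\<^sub>0\<^sub>p\<close> to \<open>aug p\<close>, and the coefficient of \<open>e\<^sub>i\<^sub>p\<close> in the image of the basis element with index \<open>q\<close>
  of \<open>F\<^sub>i\<^sub>+\<^sub>1\<close> is \<open>bd i q p\<close>. An element of \<open>F\<^sub>i\<close> is given by its coordinates, a function
  \<open>nat \<Rightarrow> S\<close> of which only the values below \<open>rank i\<close> matter. As \<open>J\<close> lies in \<open>S\<close>, the shifts in a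
  minimal resolution are natural numbers.
\<close>

record (overloaded) ('n, 'k) free_complex =
  rank :: "nat \<Rightarrow> nat"
  shift :: "nat \<Rightarrow> nat \<Rightarrow> nat"
  aug :: "nat \<Rightarrow> ('n, 'k) mpoly"
  bd :: "nat \<Rightarrow> nat \<Rightarrow> nat \<Rightarrow> ('n, 'k) mpoly"

definition apply_aug ::
    "('n::finite, 'k::field) free_complex \<Rightarrow> (nat \<Rightarrow> ('n, 'k) mpoly) \<Rightarrow> ('n, 'k) mpoly" where
  "apply_aug F v = (\<Sum>p<rank F 0. v p * aug F p)"

definition apply_bd :: "('n::finite, 'k::field) free_complex \<Rightarrow> nat \<Rightarrow>
    (nat \<Rightarrow> ('n, 'k) mpoly) \<Rightarrow> nat \<Rightarrow> ('n, 'k) mpoly" where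
  "apply_bd F i v p = (\<Sum>q<rank F (Suc i). v q * bd F i q p)"

definition graded_free_resolution ::
    "('n::finite, 'k::field) mpoly set \<Rightarrow> ('n, 'k) free_complex \<Rightarrow> bool" where
  "graded_free_resolution J F \<longleftrightarrow>
     (\<forall>p<rank F 0. homogeneous (shift F 0 p) (aug F p)) \<and>
     (\<forall>i. \<forall>q<rank F (Suc i). \<forall>p<rank F i. \<forall>m\<in>Poly_Mapping.keys (bd F i q p).
        mono_degree m + shift F i p = shift F (Suc i) q) \<and>
     range (apply_aug F) = J \<and>
     (\<forall>v. apply_aug F v = 0 \<longleftrightarrow> (\<exists>w. \<forall>p<rank F 0. v p = apply_bd F 0 w p)) \<and>
     (\<forall>i v. (\<forall>p<rank F i. apply_bd F i v p = 0) \<longleftrightarrow>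
        (\<exists>w. \<forall>q<rank F (Suc i). v q = apply_bd F (Suc i) w q))"

text \<open>Minimality: the image of \<open>F\<^sub>i\<^sub>+\<^sub>1\<close> lies in \<open>(x\<^sub>1, \<dots>, x\<^sub>n) F\<^sub>i\<close>.\<close>

definition minimal_graded_free_resolution ::
    "('n::finite, 'k::field) mpoly set \<Rightarrow> ('n, 'k) free_complex \<Rightarrow> bool" where
  "minimal_graded_free_resolution J F \<longleftrightarrow> graded_free_resolution J F \<and>
     (\<forall>i. \<forall>q<rank F (Suc i). \<forall>p<rank F i. Poly_Mapping.lookup (bd F i q p) 0 = 0)"

text \<open>Minimal graded free resolutions are unique up to isomorphism, so the choice is immaterial.\<close>

definition graded_betti :: "('n::finite, 'k::field) mpoly set \<Rightarrow> nat \<Rightarrow> nat \<Rightarrow> nat" where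
  "graded_betti J i j =
     (let F = (SOME F. minimal_graded_free_resolution J F)
      in card {p. p < rank F i \<and> shift F i p = j})"

text \<open>The value is unspecified for the zero ideal, and non-negative for every other graded ideal.\<close>

definition regularity :: "('n::finite, 'k::field) mpoly set \<Rightarrow> int" where
  "regularity J = Max {int j - int i | i j. graded_betti J i j \<noteq> 0}"

definition has_linear_resolution :: "('n::finite, 'k::field) mpoly set \<Rightarrow> bool" where
  "has_linear_resolution J \<longleftrightarrow>
     (\<exists>d. (\<exists>G. (\<forall>g\<in>G. homogeneous d g) \<and> J = ideal_gen G) \<and> regularity J = int d)"

end

theory Submission
  imports Defs "HOL-Library.Function_Algebras"
begin

text \<open>
  Suppose that \<open>I\<^sup>k = \<Inter>\<^sub>j P\<^sub>j\<^bsup>d\<^sub>j\<^esup>\<close> with monomial primes \<open>P\<^sub>j\<close>. Every monomial of an element of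
  \<open>P\<^sub>j\<^bsup>d\<^sub>j\<^esup>\<close> has degree at least \<open>d\<^sub>j\<close>, so each \<open>d\<^sub>j\<close> is at most the degree of any monomial that
  occurs in \<open>I\<^sup>k\<close>. On the other hand \<open>I \<subseteq> P\<^sub>j\<close>, so some primary component \<open>Q\<close> of \<open>I\<close> at a minimal prime
  lies in \<open>P\<^sub>j\<close>. For \<open>t \<ge> d\<^sub>j\<close> this gives \<open>I\<^bsup>(t)\<^esup> \<subseteq> Q\<^sup>t \<subseteq> P\<^sub>j\<^sup>t \<subseteq> P\<^sub>j\<^bsup>d\<^sub>j\<^esup>\<close>. Hence \<open>I\<^bsup>(t)\<^esup> \<subseteq> I\<^sup>k\<close> as soon as
  a monomial of degree at most \<open>t\<close> occurs in \<open>I\<^sup>k\<close>; this is \<open>symbolic_power_subset_power\<close>, and all the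
  inclusions of the theorem are instances of it.

  For the regularity, a minimal graded free resolution of \<open>I\<^sup>k\<close> has a generator in homological degree
  \<open>0\<close>, whose degree is both the degree of monomials in \<open>I\<^sup>k\<close> and one of the numbers whose
  maximum is the regularity (\<open>element_degree_le_regularity\<close>). For this one must know that a minimal
  resolution exists (\<open>minimal_graded_free_resolution_exists\<close>, from Hilbert's basis theorem for
  submodules of a free module) and that the maximum is over a finite set (\<open>hilbert_syzygy\<close>).

  For the asymptotic statements, a graded reduction \<open>J\<close> of \<open>I\<close> with \<open>\<theta>(J) = \<rho>(I)\<close> is nonzero, so a monomial
  of degree at most \<open>\<rho>(I)\<close> occurs in \<open>J \<subseteq> I\<close>. As \<open>I\<close> is a monomial ideal, it contains that monomial, and
  the \<open>k\<close>-th power of the monomial lies in \<open>I\<^sup>k\<close> and has degree at most \<open>\<rho>(I) k\<close>. Finally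
  \<open>\<rho>(I) \<le> \<theta>(I)\<close>, because \<open>I\<close> is a reduction of itself.
\<close>

section \<open>Hilbert's basis theorem for submodules of a free module\<close>

lemma nat_sequence_mono_subsequence:
  fixes s :: "nat \<Rightarrow> nat"
  shows "\<exists>\<phi> :: nat \<Rightarrow> nat. strict_mono \<phi> \<and> mono (\<lambda>n. s (\<phi> n))"
proof -
  \<comment> \<open>Each index of the subsequence minimises \<open>s\<close> over all indices beyond the previous one.\<close>
  have min: "\<exists>y. x < y \<and> (\<forall>k>x. s y \<le> s k)" for x
    using ex_has_least_nat[of "\<lambda>y. x < y" "Suc x" s] by auto
  obtain \<phi> where \<phi>: "\<And>n. (\<exists>x. x < \<phi> n \<and> (\<forall>k>x. s (\<phi> n) \<le> s k)) \<and> \<phi> n < \<phi> (Suc n)"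
    using dependent_nat_choice[of "\<lambda>_ y. \<exists>x. x < y \<and> (\<forall>k>x. s y \<le> s k)" "\<lambda>_ x y. x < y"] min
    by metis
  have "s (\<phi> n) \<le> s (\<phi> (Suc n))" for n
    using \<phi>[of n] by (meson less_trans)
  with \<phi> show ?thesis
    by (intro exI[of _ \<phi>]) (auto simp: strict_mono_Suc_iff mono_iff_le_Suc)
qed

text \<open>
  Dickson's lemma in the form of a subsequence that increases in finitely many coordinates at once:
  it is extracted one coordinate at a time.
\<close>

lemma dickson:
  fixes f :: "'i \<Rightarrow> nat \<Rightarrow> nat"
  assumes "finite A"
  shows "\<exists>\<phi> :: nat \<Rightarrow> nat. strict_mono \<phi> \<and> (\<forall>a\<in>A. mono (\<lambda>n. f a (\<phi> n)))"
  using assms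
proof (induction A)
  case empty
  show ?case by (intro exI[of _ id]) (auto simp: strict_mono_def)
next
  case (insert a A)
  then obtain \<phi> :: "nat \<Rightarrow> nat" where \<phi>: "strict_mono \<phi>" "\<forall>a\<in>A. mono (\<lambda>n. f a (\<phi> n))" by blast
  obtain \<psi> :: "nat \<Rightarrow> nat" where \<psi>: "strict_mono \<psi>" "mono (\<lambda>n. f a (\<phi> (\<psi> n)))"
    using nat_sequence_mono_subsequence[of "\<lambda>n. f a (\<phi> n)"] by blast
  have "mono (\<lambda>n. f b (\<phi> (\<psi> n)))" if "b \<in> A" for b
    using \<phi>(2) \<psi>(1) that by (auto simp: mono_def strict_mono_less_eq)
  with \<phi> \<psi> show ?case
    by (intro exI[of _ "\<phi> \<circ> \<psi>"]) (auto simp: strict_mono_def)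
qed

text \<open>
  A monomial order whose values are natural numbers, and which is therefore automatically well-founded:
  send the variables to distinct primes. Injectivity is unique factorisation.
\<close>

lemma exists_monomial_weight:
  "\<exists>w :: ('j::finite \<Rightarrow> nat) \<Rightarrow> nat. inj w \<and> (\<forall>a b. w (\<lambda>j. a j + b j) = w a * w b) \<and> (\<forall>a. w a > 0)"
proof -
  obtain T :: "nat set" where T: "finite T" "card T = card (UNIV :: 'j set)" "T \<subseteq> {p. prime p}"
    using infinite_arbitrarily_large[OF primes_infinite] by metis
  obtain h :: "'j \<Rightarrow> nat" where h: "bij_betw h UNIV T"
    using T finite_same_card_bij[of "UNIV :: 'j set" T] by auto
  have inj: "inj h" and pr: "\<And>j. prime (h j)"
    using h T by (auto simp: bij_betw_def)
  define w where "w = (\<lambda>a :: 'j \<Rightarrow> nat. \<Prod>j\<in>UNIV. h j ^ a j)"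
  have mult: "multiplicity (h j) (w a) = a j" for a j
  proof -
    have "w a = (\<Prod>p\<in>range h. p ^ a (inv_into UNIV h p))"
      unfolding w_def using inj by (subst prod.reindex) (auto simp: inv_into_f_f)
    then show ?thesis
      using multiplicity_prod_prime_powers[of "range h" "h j" "\<lambda>p. a (inv_into UNIV h p)"] pr inj by (auto simp: inv_into_f_f)
  qed
  have "inj w" by (rule injI) (metis ext mult)
  moreover have "w (\<lambda>j. a j + b j) = w a * w b" for a b
    by (simp add: w_def power_add prod.distrib)
  moreover have "w a > 0" for a
    unfolding w_def using pr by (intro prod_pos) (auto simp: prime_gt_0_nat)
  ultimately show ?thesis by blast
qed

text \<open>
  Vectors of length \<open>r\<close> are functions on the natural numbers that vanish from \<open>r\<close> on, so that
  free modules of all ranks live in one type.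
\<close>

definition vscale :: "'a::comm_ring_1 \<Rightarrow> (nat \<Rightarrow> 'a) \<Rightarrow> nat \<Rightarrow> 'a" where
  "vscale c v = (\<lambda>p. c * v p)"

interpretation vec: Modules.module "vscale :: 'a::comm_ring_1 \<Rightarrow> (nat \<Rightarrow> 'a) \<Rightarrow> nat \<Rightarrow> 'a"
  by unfold_locales (auto simp: vscale_def fun_eq_iff algebra_simps)

lemma vscale_apply [simp]: "vscale c v p = c * v p"
  by (simp add: vscale_def)

lemma sum_fun_apply: "(\<Sum>a\<in>A. f a) p = (\<Sum>a\<in>A. f a p)"
  for f :: "'b \<Rightarrow> nat \<Rightarrow> 'a::comm_monoid_add"
  by (induction A rule: infinite_finite_induct) auto

lemma lookup_single_times:
  fixes f :: "'a::cancel_comm_monoid_add \<Rightarrow>\<^sub>0 'k::comm_semiring_1"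
  shows "Poly_Mapping.lookup (Poly_Mapping.single a c * f) (a + m) = c * Poly_Mapping.lookup f m"
proof -
  have "f = Poly_Mapping.single m (Poly_Mapping.lookup f m) + Poly_Mapping.update m 0 f"
    by (rule poly_mapping_eqI) (auto simp: lookup_add lookup_update lookup_single when_def)
  then have "Poly_Mapping.single a c * f =
      Poly_Mapping.single (a + m) (c * Poly_Mapping.lookup f m)
      + Poly_Mapping.single a c * Poly_Mapping.update m 0 f"
    by (metis distrib_left mult_single)
  moreover have "a + m \<notin> Poly_Mapping.keys (Poly_Mapping.single a c * Poly_Mapping.update m 0 f)"
    using keys_mult[of "Poly_Mapping.single a c" "Poly_Mapping.update m 0 f"]
    by (auto simp: keys_update split: if_splits)
  ultimately show ?thesis
    by (simp add: lookup_add in_keys_iff)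
qed

lemma keys_single_times:
  fixes f :: "'a::cancel_comm_monoid_add \<Rightarrow>\<^sub>0 'k::comm_semiring_1"
  assumes "m \<in> Poly_Mapping.keys (Poly_Mapping.single a c * f)"
  shows "\<exists>m'\<in>Poly_Mapping.keys f. m = a + m'"
  using assms keys_mult[of "Poly_Mapping.single a c" f] by (auto split: if_splits)

text \<open>
  If \<open>Z\<close> is not finitely generated, pick \<open>v\<^sub>0, v\<^sub>1, \<dots>\<close> in turn, each with the smallest possible leading term
  among the elements of \<open>Z\<close> outside the span of the previous ones. By Dickson's lemma the leading term of
  some \<open>v\<^sub>i\<close> divides that of a later \<open>v\<^sub>j\<close>. Cancelling it produces an element that has a smaller leading term
  than \<open>v\<^sub>j\<close> and is still outside the span, which contradicts the choice of \<open>v\<^sub>j\<close>.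
\<close>

theorem hilbert_basis_free_module:
  fixes Z :: "(nat \<Rightarrow> ('n::finite, 'k::field) mpoly) set"
  assumes Z: "vec.subspace Z" and supp: "\<And>v p. v \<in> Z \<Longrightarrow> r \<le> p \<Longrightarrow> v p = 0"
  shows "\<exists>G. finite G \<and> vec.span G = Z"
proof (rule ccontr)
  assume no: "\<not> (\<exists>G. finite G \<and> vec.span G = Z)"
  obtain w :: "('n option \<Rightarrow> nat) \<Rightarrow> nat" where w: "inj w" "\<And>a b. w (\<lambda>j. a j + b j) = w a * w b" "\<And>a. w a > 0"
    using exists_monomial_weight by metis
  \<comment> \<open>The position of a term in the vector is treated as the exponent of one more variable.\<close>
  define code where "code = (\<lambda>(m :: 'n \<Rightarrow>\<^sub>0 nat) p :: nat.
    w (\<lambda>j. case j of None \<Rightarrow> p | Some i \<Rightarrow> Poly_Mapping.lookup m i))"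
  have code_inj: "m = m' \<and> p = p'" if "code m p = code m' p'" for m m' p p'
  proof -
    have eq: "(\<lambda>j. case j of None \<Rightarrow> p | Some i \<Rightarrow> Poly_Mapping.lookup m i) =
        (\<lambda>j. case j of None \<Rightarrow> p' | Some i \<Rightarrow> Poly_Mapping.lookup m' i)"
      using that w(1) unfolding code_def by (rule injD[rotated])
    have "p = p'" using fun_cong[OF eq, of None] by simp
    moreover have "Poly_Mapping.lookup m i = Poly_Mapping.lookup m' i" for i
      using fun_cong[OF eq, of "Some i"] by simp
    ultimately show ?thesis by (auto intro: poly_mapping_eqI)
  qed
  have code_add: "code (a + m) p = code a 0 * code m p" for a m p
    unfolding code_def w(2)[symmetric]
    by (rule arg_cong[where f = w]) (auto simp: fun_eq_iff lookup_add split: option.split)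
  have code_pos: "code m p > 0" for m p unfolding code_def by (rule w(3))

  define bdd where "bdd = (\<lambda>b (v :: nat \<Rightarrow> ('n, 'k) mpoly). \<forall>p. \<forall>m\<in>Poly_Mapping.keys (v p). code m p < b)"
  have bdd_ex: "\<exists>b. bdd b v" if "v \<in> Z" for v
  proof -
    let ?T = "\<Union>p<r. (\<lambda>m. code m p) ` Poly_Mapping.keys (v p)"
    have "finite ?T" by auto
    then obtain b where b: "\<forall>x\<in>?T. x < b" by (meson finite_nat_set_iff_bounded)
    have "code m p < b" if "m \<in> Poly_Mapping.keys (v p)" for m p
    proof -
      have "p < r" using supp[OF \<open>v \<in> Z\<close>, of p] that by (cases "p < r") auto
      then show ?thesis using b that by auto
    qed
    then show ?thesis unfolding bdd_def by blast
  qed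
  \<comment> \<open>\<open>b\<close> is the code of the leading term of \<open>v\<close>, and no admissible vector has a smaller one.\<close>
  define P where "P = (\<lambda>(f :: nat \<Rightarrow> nat \<Rightarrow> ('n, 'k) mpoly) n (v, b).
    v \<in> Z - vec.span (f ` {..<n}) \<and> bdd (Suc b) v \<and>
    (\<forall>v'\<in>Z - vec.span (f ` {..<n}). \<not> bdd b v'))"
  have "\<exists>f. \<forall>n. P (fst \<circ> f) n (f n)"
  proof (rule dependent_wellorder_choice)
    show "P (fst \<circ> f) n x = P (fst \<circ> g) n x" if "\<And>y. y < n \<Longrightarrow> f y = g y" for x f g n
    proof -
      have "(fst \<circ> f) ` {..<n} = (fst \<circ> g) ` {..<n}" using that by (intro image_cong) auto
      then show ?thesis by (simp add: P_def)
    qed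
  next
    fix n and f :: "nat \<Rightarrow> (nat \<Rightarrow> ('n, 'k) mpoly) \<times> nat"
    assume IH: "\<And>y. y < n \<Longrightarrow> P (fst \<circ> f) y (f y)"
    let ?S = "vec.span ((fst \<circ> f) ` {..<n})"
    have "(fst \<circ> f) ` {..<n} \<subseteq> Z" using IH by (force simp: P_def split: prod.splits)
    then have "?S \<subseteq> Z" using Z by (rule vec.span_minimal)
    moreover have "?S \<noteq> Z" using no by blast
    ultimately obtain v0 where v0: "v0 \<in> Z - ?S" by blast
    define Q where "Q b = (\<exists>v\<in>Z - ?S. bdd b v)" for b
    have ex: "\<exists>b. Q b" using v0 bdd_ex unfolding Q_def by blast
    have "\<not> Q 0"
    proof
      assume "Q 0"
      then obtain v where v: "v \<in> Z - ?S" "bdd 0 v" unfolding Q_def by blast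
      then have "v = 0" by (auto simp: bdd_def fun_eq_iff simp flip: keys_eq_empty) 
      with v(1) show False using vec.span_zero by blast
    qed
    then obtain b where b: "Q (Suc b)" "\<not> Q b" using ex
      by (metis exists_least_lemma)
    from b(1) obtain v where "v \<in> Z - ?S" "bdd (Suc b) v" unfolding Q_def by blast
    with b(2) have "P (fst \<circ> f) n (v, b)" unfolding P_def Q_def by auto
    then show "\<exists>x. P (fst \<circ> f) n x" by blast
  qed
  then obtain f where f: "\<And>n. P (fst \<circ> f) n (f n)" by blast
  define v where "v = fst \<circ> f"
  define b where "b = snd \<circ> f"
  have vZ: "v n \<in> Z" and vspan: "v n \<notin> vec.span (v ` {..<n})" and bv: "bdd (Suc (b n)) (v n)"
    and least: "\<And>v'. v' \<in> Z - vec.span (v ` {..<n}) \<Longrightarrow> \<not> bdd (b n) v'" for n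
    using f[of n] by (auto simp: P_def v_def b_def split: prod.splits)
  have "\<exists>m p. m \<in> Poly_Mapping.keys (v n p) \<and> code m p = b n" for n
    using least[of "v n" n] vZ[of n] vspan[of n] bv[of n] by (auto simp: bdd_def less_Suc_eq)
  then obtain m p where mp: "\<And>n. m n \<in> Poly_Mapping.keys (v n (p n))" "\<And>n. code (m n) (p n) = b n"
    by metis
  have pr: "p n < r" for n using supp[OF vZ, of "p n" n] mp(1)[of n] by (cases "p n < r") auto
  \<comment> \<open>Dickson's lemma must yield equal positions, so both \<open>p\<close> and \<open>r - p\<close> are made to increase.\<close>
  define h where "h = (\<lambda>(c :: 'n + bool) n. case c of Inl i \<Rightarrow> Poly_Mapping.lookup (m n) i
     | Inr c \<Rightarrow> if c then p n else r - p n)"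
  obtain \<phi> :: "nat \<Rightarrow> nat" where \<phi>: "strict_mono \<phi>" "\<And>a. mono (\<lambda>n. h a (\<phi> n))"
    using dickson[of UNIV h] by auto
  define i j where "i = \<phi> 0" and "j = \<phi> 1"
  have ij: "i < j" using \<phi>(1) by (simp add: i_def j_def strict_mono_def)
  have hle: "h a i \<le> h a j" for a
    using monoD[OF \<phi>(2)[of a], of 0 1] by (simp add: i_def j_def)
  have peq: "p i = p j"
    using hle[of "Inr True"] hle[of "Inr False"] pr[of i] pr[of j] by (simp add: h_def)
  have le: "Poly_Mapping.lookup (m i) x \<le> Poly_Mapping.lookup (m j) x" for x
    using hle[of "Inl x"] by (simp add: h_def)
  define a where "a = m j - m i"
  have mj: "m j = a + m i"
    by (rule poly_mapping_eqI) (simp add: a_def lookup_add lookup_minus le)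
  define c where "c = Poly_Mapping.lookup (v j (p j)) (m j) / Poly_Mapping.lookup (v i (p i)) (m i)"
  have nz: "Poly_Mapping.lookup (v i (p i)) (m i) \<noteq> 0" using mp(1)[of i] by (simp add: in_keys_iff)
  define u where "u = v j - vscale (Poly_Mapping.single a c) (v i)"
  have "v i \<in> vec.span (v ` {..<j})" using ij by (intro vec.span_base) auto
  then have sc: "vscale (Poly_Mapping.single a c) (v i) \<in> vec.span (v ` {..<j})" by (rule vec.span_scale)
  have "u \<notin> vec.span (v ` {..<j})"
    using vec.span_add[OF _ sc, of u] vspan[of j] by (auto simp: u_def)
  moreover have "u \<in> Z" unfolding u_def using vZ Z by (intro vec.subspace_diff vec.subspace_scale)
  ultimately have "\<not> bdd (b j) u" using least by blast
  then obtain q l where ql: "l \<in> Poly_Mapping.keys (u q)" "\<not> code l q < b j" unfolding bdd_def by blast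
  have l: "l \<in> Poly_Mapping.keys (v j q) \<or> l \<in> Poly_Mapping.keys (Poly_Mapping.single a c * v i q)"
    using ql(1) by (auto simp: u_def in_keys_iff lookup_minus)
  have "code l q \<le> b j"
    using l
  proof
    assume "l \<in> Poly_Mapping.keys (v j q)"
    with bv[of j] show ?thesis unfolding bdd_def by fastforce
  next
    assume "l \<in> Poly_Mapping.keys (Poly_Mapping.single a c * v i q)"
    then obtain l' where l': "l' \<in> Poly_Mapping.keys (v i q)" "l = a + l'" using keys_single_times by blast
    with bv[of i] have "code l' q \<le> b i" unfolding bdd_def by fastforce
    then have "code l q \<le> code a 0 * code (m i) (p i)" by (simp add: l'(2) code_add mp(2))
    then show ?thesis by (simp add: code_add[symmetric] mj[symmetric] peq mp(2))
  qed
  with ql(2) have "code l q = code (m j) (p j)" by (simp add: mp(2))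
  then have lq: "l = m j" "q = p j" using code_inj by blast+
  have "Poly_Mapping.lookup (u q) l = 0"
    using nz by (simp add: lq u_def lookup_minus mj lookup_single_times peq[symmetric] c_def)
  with ql(1) show False by (simp add: in_keys_iff)
qed

lemma (in Modules.module) finite_spanning_subset:
  assumes "finite B" "span B = span V"
  shows "\<exists>G\<subseteq>V. finite G \<and> span G = span V"
proof -
  have "\<exists>G. G \<subseteq> V \<and> finite G \<and> b \<in> span G" if "b \<in> B" for b
  proof -
    have "b \<in> span V" using assms span_base[OF that] by simp
    then show ?thesis unfolding span_explicit by blast
  qed
  then obtain G where G: "\<And>b. b \<in> B \<Longrightarrow> G b \<subseteq> V \<and> finite (G b) \<and> b \<in> span (G b)" by metis
  define H where "H = (\<Union>b\<in>B. G b)"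
  have "B \<subseteq> span H" using G span_mono[of _ H] unfolding H_def by blast
  then have "span V \<subseteq> span H" using assms(2) span_minimal[of B "span H"] by auto
  moreover have "H \<subseteq> V" "finite H" using G assms(1) by (auto simp: H_def)
  ultimately show ?thesis using span_mono[of H V] by blast
qed

section \<open>Ideals as submodules\<close>

interpretation idl: Modules.module "times :: 'a::comm_ring_1 \<Rightarrow> 'a \<Rightarrow> 'a"
  by unfold_locales (auto simp: algebra_simps)

(* For this action scale_scale is associativity of multiplication, oriented against mult.assoc. *)
declare idl.scale_scale [simp del]

lemma ring_of_type_algebra_simps [simp]:
  "carrier ring_of_type_algebra = UNIV"
  "x \<otimes>\<^bsub>ring_of_type_algebra\<^esub> y = x * y"
  "x \<oplus>\<^bsub>ring_of_type_algebra\<^esub> y = x + y"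
  "\<one>\<^bsub>ring_of_type_algebra\<^esub> = 1"
  "\<zero>\<^bsub>ring_of_type_algebra\<^esub> = 0"
  by (simp_all add: ring_of_type_algebra_def)

text \<open>
  Together with \<open>ideal_gen_eq_span\<close> below, this makes the library of submodules and spans available for ideals.
\<close>

lemma is_ideal_iff_subspace:
  fixes I :: "'a::comm_ring_1 set"
  shows "is_ideal I \<longleftrightarrow> idl.subspace I"
proof -
  interpret R: cring "ring_of_type_algebra :: 'a ring" by (rule cring_from_type_algebra)
  show ?thesis
  proof
    assume "is_ideal I"
    then interpret ideal I "ring_of_type_algebra :: 'a ring" .
    show "idl.subspace I"
      using zero_closed a_closed I_l_closed by (intro idl.subspaceI) auto
  next
    assume I: "idl.subspace I"
    have "subgroup I (add_monoid ring_of_type_algebra)"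
    proof (rule R.add.subgroupI)
      show "I \<noteq> {}" using idl.subspace_0[OF I] by blast
      fix x y :: 'a assume x: "x \<in> I"
      have "\<ominus>\<^bsub>ring_of_type_algebra\<^esub> x = - x" by (rule R.minus_equality) auto
      then show "\<ominus>\<^bsub>ring_of_type_algebra\<^esub> x \<in> I" using idl.subspace_neg[OF I x] by simp
      assume "y \<in> I"
      then show "x \<oplus>\<^bsub>ring_of_type_algebra\<^esub> y \<in> I" using idl.subspace_add[OF I x] by simp
    qed auto
    then show "is_ideal I"
      by (intro idealI R.ring_axioms)
        (use idl.subspace_scale[OF I] in \<open>auto simp: mult.commute\<close>)
  qed
qed

lemma ideal_gen_eq_span: "ideal_gen A = idl.span A"
  by (auto simp: genideal_def is_ideal_iff_subspace idl.span_def hull_def)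

lemma is_prime_ideal_iff:
  fixes P :: "'a::comm_ring_1 set"
  shows "is_prime_ideal P \<longleftrightarrow> is_ideal P \<and> P \<noteq> UNIV \<and> (\<forall>a b. a * b \<in> P \<longrightarrow> a \<in> P \<or> b \<in> P)"
  unfolding primeideal_def primeideal_axioms_def using cring_from_type_algebra[where 'a = 'a] by auto

lemma ideal_mult_subset:
  assumes "is_ideal K" "\<And>i j. i \<in> I \<Longrightarrow> j \<in> J \<Longrightarrow> i * j \<in> K"
  shows "ideal_mult I J \<subseteq> K"
proof
  fix x assume "x \<in> ideal_mult I J"
  then show "x \<in> K"
    by induction (use assms in \<open>auto simp: is_ideal_iff_subspace intro: idl.subspace_add\<close>)
qed

lemma ideal_mult_I: "i \<in> I \<Longrightarrow> j \<in> J \<Longrightarrow> i * j \<in> ideal_mult I J"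
  using ideal_prod.prod[of i I j J ring_of_type_algebra] by simp

lemma is_ideal_mult: "is_ideal I \<Longrightarrow> is_ideal J \<Longrightarrow> is_ideal (ideal_mult I J)"
  by (rule ring.ideal_prod_is_ideal) (auto intro: ring_from_type_algebra)

lemma is_ideal_UNIV: "is_ideal UNIV"
  by (simp add: is_ideal_iff_subspace)

lemma is_ideal_ideal_gen: "is_ideal (ideal_gen A)"
  by (simp add: is_ideal_iff_subspace ideal_gen_eq_span)

lemma ideal_mult_UNIV_left: "ideal_mult UNIV I = I" if "is_ideal I"
proof
  show "ideal_mult UNIV I \<subseteq> I"
    using that by (intro ideal_mult_subset) (auto simp: is_ideal_iff_subspace intro: idl.subspace_scale)
  show "I \<subseteq> ideal_mult UNIV I" using ideal_mult_I[of 1 UNIV _ I] by auto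
qed

lemma ideals_set_simps [simp]:
  "I \<otimes>\<^bsub>ideals_set ring_of_type_algebra\<^esub> J = ideal_mult I J"
  "\<one>\<^bsub>ideals_set ring_of_type_algebra\<^esub> = UNIV"
  by (simp_all add: ideals_set_def)

lemma ideal_power_0: "ideal_power I 0 = UNIV"
  and ideal_power_Suc: "ideal_power I (Suc k) = ideal_mult (ideal_power I k) I"
  by simp_all

lemma ideal_power_1: "ideal_power I 1 = I" if "is_ideal I"
  using that by (simp add: ideal_mult_UNIV_left)

lemma is_ideal_power: "is_ideal I \<Longrightarrow> is_ideal (ideal_power I k)"
  by (induction k) (auto simp: is_ideal_UNIV intro: is_ideal_mult)

lemma ideal_power_mono: "is_ideal J \<Longrightarrow> I \<subseteq> J \<Longrightarrow> ideal_power I k \<subseteq> ideal_power J k"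
proof (induction k)
  case (Suc k)
  then show ?case unfolding ideal_power_Suc
    by (intro ideal_mult_subset is_ideal_mult is_ideal_power) (auto intro!: ideal_mult_I)
qed (simp add: ideal_power_0)

lemma ideal_power_antimono: "is_ideal I \<Longrightarrow> j \<le> k \<Longrightarrow> ideal_power I k \<subseteq> ideal_power I j"
proof (induction k)
  case (Suc k)
  have "ideal_power I (Suc k) \<subseteq> ideal_power I k"
    unfolding ideal_power_Suc using is_ideal_power[OF Suc.prems(1), of k]
    by (intro ideal_mult_subset) (auto simp: is_ideal_iff_subspace mult.commute dest: idl.subspace_scale)
  with Suc show ?case by (cases "j = Suc k") auto
qed auto

lemma power_in_ideal_power: "f \<in> I \<Longrightarrow> f ^ k \<in> ideal_power I k"
  by (induction k) (auto simp: mult.commute[of f] intro: ideal_mult_I)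

text \<open>
  If \<open>a \<in> Q\<close> is not in \<open>P\<close>, then multiplying by \<open>a\<close> carries the
  intersection of the remaining ideals into the whole intersection, and primality cancels \<open>a\<close>.
\<close>

lemma prime_ideal_contains_Inter:
  assumes "finite \<Q>" "is_prime_ideal P" "\<Inter>\<Q> \<subseteq> P" "\<And>Q. Q \<in> \<Q> \<Longrightarrow> is_ideal Q"
  shows "\<exists>Q\<in>\<Q>. Q \<subseteq> P"
  using assms
proof (induction \<Q>)
  case empty
  then show ?case by (auto simp: is_prime_ideal_iff)
next
  case (insert Q \<Q>)
  show ?case
  proof (cases "Q \<subseteq> P")
    case False
    then obtain a where a: "a \<in> Q" "a \<notin> P" by blast
    have "\<Inter>\<Q> \<subseteq> P"
    proof
      fix b assume b: "b \<in> \<Inter>\<Q>"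
      have "b * a \<in> Q" using insert.prems(3)[of Q] a(1) by (auto simp: is_ideal_iff_subspace idl.subspace_scale)
      moreover have "a * b \<in> Q'" if "Q' \<in> \<Q>" for Q'
        using insert.prems(3)[of Q'] b that by (auto simp: is_ideal_iff_subspace idl.subspace_scale)
      ultimately have "a * b \<in> P" using insert.prems(2) by (auto simp: mult.commute)
      then show "b \<in> P" using insert.prems(1) a(2) by (auto simp: is_prime_ideal_iff)
    qed
    then show ?thesis using insert by auto
  qed auto
qed

section \<open>Primary decomposition\<close>

lemma primary_ideal_Int:
  assumes "primary_ideal Q" "primary_ideal Q'" "ideal_radical Q = ideal_radical Q'"
  shows "primary_ideal (Q \<inter> Q')"
  unfolding primary_ideal_def
proof (intro conjI allI impI)
  show "is_ideal (Q \<inter> Q')" "Q \<inter> Q' \<noteq> UNIV"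
    using assms by (auto simp: primary_ideal_def is_ideal_iff_subspace idl.subspace_inter)
  fix f g assume fg: "f * g \<in> Q \<inter> Q'"
  show "f \<in> Q \<inter> Q' \<or> (\<exists>m. g ^ m \<in> Q \<inter> Q')"
  proof (cases "f \<in> Q \<inter> Q'")
    case False
    then have "g \<in> ideal_radical Q" "g \<in> ideal_radical Q'"
      using assms fg unfolding primary_ideal_def ideal_radical_def by blast+
    then obtain m m' where m: "g ^ m \<in> Q" "g ^ m' \<in> Q'" by (auto simp: ideal_radical_def)
    then have "g ^ m' * g ^ m \<in> Q" "g ^ m * g ^ m' \<in> Q'"
      using assms by (auto simp: primary_ideal_def is_ideal_iff_subspace intro: idl.subspace_scale)
    then have "g ^ (m + m') \<in> Q \<inter> Q'" by (simp add: power_add mult.commute)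
    then show ?thesis by blast
  qed auto
qed

text \<open>
  The radical is closed under addition since each term of the binomial expansion of \<open>(x + y)\<^bsup>m + k\<^esup>\<close> is
  divisible by \<open>x\<^sup>m\<close> or by \<open>y\<^sup>k\<close>.
\<close>

lemma is_prime_ideal_radical:
  assumes "primary_ideal Q"
  shows "is_prime_ideal (ideal_radical Q)"
proof -
  have Q: "idl.subspace Q" and nt: "1 \<notin> Q" and
    pr: "\<And>f g. f * g \<in> Q \<Longrightarrow> f \<in> Q \<or> (\<exists>m. g ^ m \<in> Q)"
    using assms idl.subspace_scale[of Q 1] by (auto simp: primary_ideal_def is_ideal_iff_subspace)
  have "idl.subspace (ideal_radical Q)"
  proof (rule idl.subspaceI)
    show "0 \<in> ideal_radical Q"
      unfolding ideal_radical_def using idl.subspace_0[OF Q] by (auto intro: exI[of _ 1])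
  next
    fix c x assume "x \<in> ideal_radical Q"
    then show "c * x \<in> ideal_radical Q"
      using idl.subspace_scale[OF Q] by (auto simp: ideal_radical_def power_mult_distrib)
  next
    fix x y assume "x \<in> ideal_radical Q" "y \<in> ideal_radical Q"
    then obtain m k where mk: "x ^ m \<in> Q" "y ^ k \<in> Q" by (auto simp: ideal_radical_def)
    have "of_nat ((m + k) choose i) * x ^ i * y ^ (m + k - i) \<in> Q" for i
    proof (cases "m \<le> i")
      case True
      then have "x ^ i = x ^ (i - m) * x ^ m" by (simp flip: power_add)
      then have "of_nat ((m + k) choose i) * x ^ i * y ^ (m + k - i) =
          of_nat ((m + k) choose i) * x ^ (i - m) * y ^ (m + k - i) * x ^ m"
        by (simp add: mult_ac)
      then show ?thesis using idl.subspace_scale[OF Q mk(1)] by simp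
    next
      case False
      then have "y ^ (m + k - i) = y ^ (m - i) * y ^ k" by (simp flip: power_add)
      then have "of_nat ((m + k) choose i) * x ^ i * y ^ (m + k - i) =
          of_nat ((m + k) choose i) * x ^ i * y ^ (m - i) * y ^ k"
        by (simp add: mult_ac)
      then show ?thesis using idl.subspace_scale[OF Q mk(2)] by simp
    qed
    then have "(x + y) ^ (m + k) \<in> Q"
      unfolding binomial_ring by (intro idl.subspace_sum[OF Q])
    then show "x + y \<in> ideal_radical Q" by (auto simp: ideal_radical_def)
  qed
  moreover have "1 \<notin> ideal_radical Q" using nt by (simp add: ideal_radical_def)
  moreover have "a \<in> ideal_radical Q \<or> b \<in> ideal_radical Q" if ab: "a * b \<in> ideal_radical Q" for a b
  proof -
    obtain m where "a ^ m * b ^ m \<in> Q" using ab by (auto simp: ideal_radical_def power_mult_distrib)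
    from pr[OF this] show ?thesis by (auto simp: ideal_radical_def simp flip: power_mult)
  qed
  ultimately show ?thesis unfolding is_prime_ideal_iff is_ideal_iff_subspace by blast
qed

lemma noetherian_maximal_ideal:
  assumes "noetherian_ring (ring_of_type_algebra :: 'a::comm_ring_1 ring)"
    and "\<A> \<noteq> {}" "\<And>I :: 'a set. I \<in> \<A> \<Longrightarrow> is_ideal I"
  shows "\<exists>M\<in>\<A>. \<forall>Y\<in>\<A>. M \<subseteq> Y \<longrightarrow> Y = M"
proof (rule subset_Zorn_nonempty[OF assms(2)])
  fix \<C> assume C: "\<C> \<noteq> {}" "subset.chain \<A> \<C>"
  then have "subset.chain {I. is_ideal I} \<C>" using assms(3) by (auto simp: subset.chain_def)
  then have "\<Union>\<C> \<in> \<C>" using noetherian_ring.ideal_chain_is_trivial[OF assms(1) C(1)] by blast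
  then show "\<Union>\<C> \<in> \<A>" using C(2) by (auto simp: subset.chain_def)
qed

text \<open>
  Noetherian induction. A largest ideal \<open>M\<close> without a decomposition is proper and not primary, say
  \<open>f g \<in> M\<close> with \<open>f \<notin> M\<close> and no power of \<open>g\<close> in \<open>M\<close>. The chain of the ideals \<open>M : g\<^sup>m\<close>
  becomes stationary, and when it does, \<open>M = (M + (g\<^sup>m)) \<inter> (M + (f))\<close>. Both ideals on the right are
  larger than \<open>M\<close>, so their decompositions combine to one of \<open>M\<close>.
\<close>

lemma primary_decomposition_exists:
  fixes I :: "'a::comm_ring_1 set"
  assumes noeth: "noetherian_ring (ring_of_type_algebra :: 'a ring)" and "is_ideal I"
  shows "\<exists>\<Q>. finite \<Q> \<and> (\<forall>Q\<in>\<Q>. primary_ideal Q) \<and> I = \<Inter>\<Q>"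
proof (rule ccontr)
  define dec where "dec = (\<lambda>I :: 'a set. \<exists>\<Q>. finite \<Q> \<and> (\<forall>Q\<in>\<Q>. primary_ideal Q) \<and> I = \<Inter>\<Q>)"
  assume "\<not> ?thesis"
  then have "{I. is_ideal I \<and> \<not> dec I} \<noteq> {}" using assms(2) by (auto simp: dec_def)
  from noetherian_maximal_ideal[OF noeth this] obtain M where M: "is_ideal M" "\<not> dec M"
    and max: "\<And>Y. is_ideal Y \<Longrightarrow> M \<subset> Y \<Longrightarrow> dec Y" by blast
  have sM: "idl.subspace M" using M(1) by (simp add: is_ideal_iff_subspace)
  have "dec UNIV" unfolding dec_def by (intro exI[of _ "{}"]) auto
  with M(2) have "M \<noteq> UNIV" by auto
  moreover have "\<not> primary_ideal M"
  proof
    assume "primary_ideal M"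
    then have "dec M" unfolding dec_def by (intro exI[of _ "{M}"]) auto
    with M(2) show False ..
  qed
  ultimately obtain f g where fg: "f * g \<in> M" "f \<notin> M" "\<And>m. g ^ m \<notin> M"
    using M(1) by (auto simp: primary_ideal_def)
  define C where "C m = {a. a * g ^ m \<in> M}" for m
  have C: "idl.subspace (C m)" for m
    using sM by (auto simp: C_def idl.subspace_def distrib_right mult.assoc)
  have Cmono: "C m \<subseteq> C (m + k)" for m k
  proof
    fix a assume "a \<in> C m"
    then have "g ^ k * (a * g ^ m) \<in> M" unfolding C_def by (blast intro: idl.subspace_scale[OF sM])
    then show "a \<in> C (m + k)" by (simp add: C_def power_add mult_ac)
  qed
  have "\<exists>N\<in>range C. \<forall>Y\<in>range C. N \<subseteq> Y \<longrightarrow> Y = N"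
    by (rule noetherian_maximal_ideal[OF noeth]) (use C in \<open>auto simp: is_ideal_iff_subspace\<close>)
  then obtain m where m: "\<And>k. C m \<subseteq> C k \<Longrightarrow> C k = C m" by auto
  have Cm: "C (m + 1) = C m" by (rule m) (use Cmono[of m 1] in auto)
  define A where "A = {a + b * g ^ m | a b. a \<in> M}"
  define B where "B = {a + b * f | a b. a \<in> M}"
  have sub: "idl.subspace {a + b * x | a b. a \<in> M}" for x
  proof (rule idl.subspaceI)
    show "0 \<in> {a + b * x | a b. a \<in> M}" using idl.subspace_0[OF sM] by (auto intro!: exI[of _ 0])
  next
    fix u v assume "u \<in> {a + b * x | a b. a \<in> M}" "v \<in> {a + b * x | a b. a \<in> M}"
    then obtain a b a' b' where "u = a + b * x" "v = a' + b' * x" "a \<in> M" "a' \<in> M" by blast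
    moreover from this have "u + v = (a + a') + (b + b') * x" by (simp add: algebra_simps)
    ultimately show "u + v \<in> {a + b * x | a b. a \<in> M}"
      using idl.subspace_add[OF sM, of a a'] by blast
  next
    fix c u assume "u \<in> {a + b * x | a b. a \<in> M}"
    then obtain a b where "u = a + b * x" "a \<in> M" by blast
    moreover from this have "c * u = c * a + (c * b) * x" by (simp add: algebra_simps)
    ultimately show "c * u \<in> {a + b * x | a b. a \<in> M}"
      using idl.subspace_scale[OF sM, of a c] by blast
  qed
  have sup: "M \<subseteq> {a + b * x | a b. a \<in> M}" "x \<in> {a + b * x | a b. a \<in> M}" for x
  proof -
    have "a = a + 0 * x" for a by simp
    then show "M \<subseteq> {a + b * x | a b. a \<in> M}" by blast
    have "x = 0 + 1 * x" by simp
    then show "x \<in> {a + b * x | a b. a \<in> M}" using idl.subspace_0[OF sM] by blast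
  qed
  have "dec {a + b * x | a b. a \<in> M}" if "x \<notin> M" for x
  proof (rule max)
    show "is_ideal {a + b * x | a b. a \<in> M}" using sub unfolding is_ideal_iff_subspace .
    show "M \<subset> {a + b * x | a b. a \<in> M}" using sup that by blast
  qed
  then have "dec A" "dec B" using fg(2,3) unfolding A_def B_def by blast+
  moreover have "A \<inter> B \<subseteq> M"
  proof
    fix h assume "h \<in> A \<inter> B"
    then obtain a b a' c where h: "h = a + b * g ^ m" "h = a' + c * f" "a \<in> M" "a' \<in> M"
      unfolding A_def B_def by blast
    have "g * h = g * a' + c * (f * g)" by (simp add: h(2) algebra_simps)
    also have "\<dots> \<in> M"
      by (intro idl.subspace_add[OF sM] idl.subspace_scale[OF sM h(4)] idl.subspace_scale[OF sM fg(1)])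
    finally have "g * h \<in> M" .
    then have "g * h - g * a \<in> M" by (intro idl.subspace_diff[OF sM] idl.subspace_scale[OF sM h(3)])
    also have "g * h - g * a = b * g ^ (m + 1)" by (simp add: h(1) algebra_simps)
    finally have "b \<in> C (m + 1)" by (simp add: C_def)
    then have "b * g ^ m \<in> M" by (simp only: Cm) (simp add: C_def)
    then show "h \<in> M" unfolding h(1) by (intro idl.subspace_add[OF sM] h(3))
  qed
  moreover have "M \<subseteq> A \<inter> B" using sup(1) by (auto simp: A_def B_def)
  ultimately have "dec M"
    unfolding dec_def
  proof (elim exE conjE)
    fix \<Q> \<Q>' assume "finite \<Q>" "finite \<Q>'" "\<forall>Q\<in>\<Q>. primary_ideal Q" "\<forall>Q\<in>\<Q>'. primary_ideal Q"
      "A = \<Inter>\<Q>" "B = \<Inter>\<Q>'" "A \<inter> B \<subseteq> M" "M \<subseteq> A \<inter> B"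
    then show "\<exists>\<Q>. finite \<Q> \<and> (\<forall>Q\<in>\<Q>. primary_ideal Q) \<and> M = \<Inter>\<Q>"
      by (intro exI[of _ "\<Q> \<union> \<Q>'"]) auto
  qed
  with M(2) show False ..
qed

text \<open>
  A decomposition with the fewest components is irredundant: two components with the same radical could be
  replaced by their intersection, and a redundant component could be dropped.
\<close>

lemma irredundant_primary_decomposition_exists:
  fixes I :: "'a::comm_ring_1 set"
  assumes "noetherian_ring (ring_of_type_algebra :: 'a ring)" and "is_ideal I"
  shows "\<exists>\<Q>. irredundant_primary_decomposition I \<Q>"
proof -
  define dec where "dec = (\<lambda>\<Q>. finite \<Q> \<and> (\<forall>Q\<in>\<Q>. primary_ideal Q) \<and> I = \<Inter>\<Q>)"
  obtain \<Q> where Q: "dec \<Q>" and min: "\<And>\<Q>'. dec \<Q>' \<Longrightarrow> card \<Q> \<le> card \<Q>'"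
    using primary_decomposition_exists[OF assms] ex_has_least_nat[of dec _ card] unfolding dec_def by metis
  have fin: "finite \<Q>" and prim: "\<And>Q. Q \<in> \<Q> \<Longrightarrow> primary_ideal Q" and I: "I = \<Inter>\<Q>"
    using Q by (auto simp: dec_def)
  have "inj_on ideal_radical \<Q>"
  proof (rule inj_onI, rule ccontr)
    fix Q R assume QR: "Q \<in> \<Q>" "R \<in> \<Q>" "ideal_radical Q = ideal_radical R" "Q \<noteq> R"
    let ?D = "insert (Q \<inter> R) (\<Q> - {Q, R})"
    have "primary_ideal (Q \<inter> R)" using prim QR by (intro primary_ideal_Int)
    moreover have "\<Inter>?D = I" using QR(1,2) unfolding I by blast
    ultimately have "dec ?D" using fin prim by (auto simp: dec_def)
    then have "card \<Q> \<le> card ?D" by (rule min)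
    also have "\<dots> \<le> Suc (card (\<Q> - {Q, R}))" by (rule card_insert_le_m1[THEN order_trans]) (auto simp: card_insert_if fin)
    also have "card (\<Q> - {Q, R}) = card \<Q> - 2"
      using fin QR by (subst card_Diff_subset) auto
    finally have "card \<Q> \<le> Suc (card \<Q> - 2)" .
    moreover have "card {Q, R} \<le> card \<Q>" using fin QR by (intro card_mono) auto
    ultimately show False using QR(4) by simp
  qed
  moreover have "\<not> \<Inter>(\<Q> - {Q}) \<subseteq> Q" if "Q \<in> \<Q>" for Q
  proof
    assume "\<Inter>(\<Q> - {Q}) \<subseteq> Q"
    then have "\<Inter>(\<Q> - {Q}) = I" using that unfolding I by blast
    then have "dec (\<Q> - {Q})" using fin prim by (auto simp: dec_def)
    then have "card \<Q> \<le> card (\<Q> - {Q})" by (rule min)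
    then show False using fin that by (metis card_Diff1_less not_le)
  qed
  ultimately show ?thesis
    using fin prim I by (auto simp: irredundant_primary_decomposition_def)
qed

text \<open>
  Among the components of a decomposition that lie in \<open>P\<close>, one whose radical is minimal belongs to a
  minimal prime of \<open>I\<close>: a prime between \<open>I\<close> and that radical contains a component, which again lies in \<open>P\<close>.
\<close>

lemma minimal_primary_component_below_prime:
  fixes I P :: "'a::comm_ring_1 set"
  assumes "noetherian_ring (ring_of_type_algebra :: 'a ring)" "is_ideal I" "is_prime_ideal P" "I \<subseteq> P"
  shows "\<exists>Q\<in>minimal_primary_components I. Q \<subseteq> P"
proof -
  obtain \<Q> where Q: "irredundant_primary_decomposition I \<Q>"
    using irredundant_primary_decomposition_exists[OF assms(1,2)] by blast
  then have fin: "finite \<Q>" and prim: "\<And>Q. Q \<in> \<Q> \<Longrightarrow> primary_ideal Q" and I: "I = \<Inter>\<Q>"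
    by (auto simp: irredundant_primary_decomposition_def)
  have below: "\<exists>Q\<in>\<Q>. Q \<subseteq> P'" if "is_prime_ideal P'" "I \<subseteq> P'" for P'
    using prime_ideal_contains_Inter[OF fin that(1)] that(2) prim by (auto simp: I primary_ideal_def)
  have rad: "ideal_radical Q \<subseteq> P'" if P': "is_prime_ideal P'" "Q \<subseteq> P'" for P' Q :: "'a set"
  proof
    fix f assume "f \<in> ideal_radical Q"
    then obtain m where "f ^ m \<in> P'" using P'(2) unfolding ideal_radical_def by blast
    then show "f \<in> P'"
    proof (induction m)
      case 0
      then have "P' = UNIV"
        using P'(1) idl.subspace_scale[of P' 1] by (auto simp: is_prime_ideal_iff is_ideal_iff_subspace)
      then show ?case by simp
    qed (use P'(1) in \<open>auto simp: is_prime_ideal_iff\<close>)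
  qed
  have self: "Q \<subseteq> ideal_radical Q" for Q :: "'a set"
    by (auto simp: ideal_radical_def intro: exI[of _ 1])
  let ?R = "ideal_radical ` {Q \<in> \<Q>. Q \<subseteq> P}"
  have "finite ?R" "?R \<noteq> {}" using fin below[OF assms(3,4)] by auto
  from finite_has_minimal[OF this] obtain R
    where R: "R \<in> ?R" "\<forall>R'\<in>?R. R' \<subseteq> R \<longrightarrow> R = R'" by blast
  from R(1) obtain Q where Q0: "Q \<in> \<Q>" "Q \<subseteq> P" and RQ: "R = ideal_radical Q" by blast
  have min: "ideal_radical Q = ideal_radical Q'"
    if "Q' \<in> \<Q>" "Q' \<subseteq> P" "ideal_radical Q' \<subseteq> ideal_radical Q" for Q'
    using R(2) that by (simp add: RQ)
  have "minimal_prime_over I (ideal_radical Q)"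
    unfolding minimal_prime_over_def
  proof (intro conjI allI impI)
    show "is_prime_ideal (ideal_radical Q)" using prim[OF Q0(1)] by (rule is_prime_ideal_radical)
    show "I \<subseteq> ideal_radical Q" using self[of Q] Q0(1) I by blast
    fix P' assume P': "is_prime_ideal P' \<and> I \<subseteq> P' \<and> P' \<subseteq> ideal_radical Q"
    then obtain Q' where Q': "Q' \<in> \<Q>" "Q' \<subseteq> P'" using below by blast
    have le: "ideal_radical Q' \<subseteq> P'" using rad P' Q'(2) by blast
    have "Q' \<subseteq> P" using Q' P' rad[OF assms(3) Q0(2)] by blast
    then have "ideal_radical Q = ideal_radical Q'" using min[OF Q'(1)] le P' by (meson order_trans)
    then show "P' = ideal_radical Q" using le P' by blast
  qed
  then show ?thesis using Q Q0 by (auto simp: minimal_primary_components_def)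
qed

section \<open>Ideals and symbolic powers in polynomial rings\<close>

definition as_vector :: "'a::comm_ring_1 \<Rightarrow> nat \<Rightarrow> 'a" where
  "as_vector f = (\<lambda>p. if p = 0 then f else 0)"

lemma subspace_image_as_vector:
  assumes I: "idl.subspace I"
  shows "vec.subspace (as_vector ` I)"
proof (rule vec.subspaceI)
  show "0 \<in> as_vector ` I"
    using idl.subspace_0[OF I] by (auto simp: as_vector_def fun_eq_iff intro!: image_eqI[of _ _ 0])
next
  fix x y assume "x \<in> as_vector ` I" "y \<in> as_vector ` I"
  then obtain f g where "x = as_vector f" "y = as_vector g" "f \<in> I" "g \<in> I" by blast
  then show "x + y \<in> as_vector ` I"
    using idl.subspace_add[OF I] by (auto simp: as_vector_def fun_eq_iff intro!: image_eqI[of _ _ "f + g"])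
next
  fix c x assume "x \<in> as_vector ` I"
  then obtain f where "x = as_vector f" "f \<in> I" by blast
  then show "vscale c x \<in> as_vector ` I"
    using idl.subspace_scale[OF I] by (auto simp: as_vector_def fun_eq_iff intro!: image_eqI[of _ _ "c * f"])
qed

lemma noetherian_polynomial_ring:
  "noetherian_ring (ring_of_type_algebra :: ('n::finite, 'k::field) mpoly ring)"
proof (rule ring.noetherian_ringI[OF ring_from_type_algebra])
  fix I :: "('n, 'k) mpoly set"
  assume "is_ideal I"
  then have I: "idl.subspace I" by (simp add: is_ideal_iff_subspace)
  have "vec.subspace (as_vector ` I)" using I by (rule subspace_image_as_vector)
  moreover have "v p = 0" if "v \<in> as_vector ` I" "1 \<le> p" for v p
    using that by (auto simp: as_vector_def)
  ultimately obtain G where G: "finite G" "vec.span G = as_vector ` I"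
    using hilbert_basis_free_module[of "as_vector ` I" 1] by blast
  have "ideal_gen ((\<lambda>v. v 0) ` G) = I"
    unfolding ideal_gen_eq_span
  proof (rule idl.span_subspace[OF _ _ I])
    show "(\<lambda>v. v 0) ` G \<subseteq> I"
      using vec.span_superset[of G] by (auto simp: G(2) as_vector_def)
    show "I \<subseteq> idl.span ((\<lambda>v. v 0) ` G)"
    proof
      fix f assume "f \<in> I"
      then have "as_vector f \<in> vec.span G" using G(2) by blast
      then obtain u where "as_vector f = (\<Sum>v\<in>G. vscale (u v) v)" using vec.span_finite[OF G(1)] by auto
      from fun_cong[OF this, of 0] have "f = (\<Sum>v\<in>G. u v * v 0)" by (simp add: as_vector_def sum_fun_apply)
      also have "\<dots> \<in> idl.span ((\<lambda>v. v 0) ` G)"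
        by (intro idl.span_sum idl.span_scale idl.span_base) auto
      finally show "f \<in> idl.span ((\<lambda>v. v 0) ` G)" .
    qed
  qed
  then show "\<exists>A\<subseteq>carrier ring_of_type_algebra. finite A \<and> I = ideal_gen A"
    using G(1) by (intro exI[of _ "(\<lambda>v. v 0) ` G"]) auto
qed

lemma finite_generating_subset:
  fixes V :: "('n::finite, 'k::field) mpoly set"
  shows "\<exists>G\<subseteq>V. finite G \<and> ideal_gen G = ideal_gen V"
proof -
  obtain B where "finite B" "ideal_gen V = ideal_gen B"
    using noetherian_ring.finetely_gen[OF noetherian_polynomial_ring is_ideal_ideal_gen, of V] by blast
  then show ?thesis
    using idl.finite_spanning_subset[of B V] by (auto simp: ideal_gen_eq_span)
qed

lemma mono_degree_add: "mono_degree (a + b) = mono_degree a + mono_degree b"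
  by (simp add: mono_degree_def lookup_add sum.distrib)

lemma mono_degree_zero [simp]: "mono_degree 0 = 0"
  by (simp add: mono_degree_def)

definition order_ideal :: "nat \<Rightarrow> ('n::finite, 'k::field) mpoly set" where
  "order_ideal d = {f. \<forall>m\<in>Poly_Mapping.keys f. d \<le> mono_degree m}"

lemma order_ideal_mult: "f \<in> order_ideal a \<Longrightarrow> g \<in> order_ideal b \<Longrightarrow> f * g \<in> order_ideal (a + b)"
  using keys_mult[of f g] by (fastforce simp: order_ideal_def mono_degree_add intro: add_mono)

lemma is_ideal_order_ideal: "is_ideal (order_ideal d :: ('n::finite, 'k::field) mpoly set)"
  unfolding is_ideal_iff_subspace
proof (rule idl.subspaceI)
  show "(0 :: ('n, 'k) mpoly) \<in> order_ideal d" by (simp add: order_ideal_def)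
  show "x + y \<in> order_ideal d" if "x \<in> order_ideal d" "y \<in> order_ideal d" for x y :: "('n, 'k) mpoly"
    using that keys_add[of x y] by (auto simp: order_ideal_def)
  show "c * x \<in> order_ideal d" if "x \<in> order_ideal d" for c x :: "('n, 'k) mpoly"
    using order_ideal_mult[of c 0 x d] that by (auto simp: order_ideal_def)
qed

lemma monomial_prime_power_order:
  assumes "monomial_prime_ideal P"
  shows "ideal_power P d \<subseteq> order_ideal d"
proof (induction d)
  case 0
  show ?case by (auto simp: order_ideal_def)
next
  case (Suc d)
  obtain A where P: "P = ideal_gen (poly_var ` A)" using assms by (auto simp: monomial_prime_ideal_def)
  have "P \<subseteq> order_ideal 1"
    unfolding P ideal_gen_eq_span
  proof (rule idl.span_minimal)
    show "poly_var ` A \<subseteq> order_ideal 1"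
      by (auto simp: order_ideal_def poly_var_def mono_degree_def lookup_single when_def)
    show "idl.subspace (order_ideal 1)" using is_ideal_order_ideal by (simp add: is_ideal_iff_subspace)
  qed
  with Suc show ?case
    unfolding ideal_power_Suc
    by (intro ideal_mult_subset is_ideal_order_ideal) (use order_ideal_mult[of _ d _ 1] in auto)
qed

text \<open>
  The central step. The monomial \<open>m\<close> bounds every exponent \<open>d\<close> in a presentation of \<open>I\<^sup>k\<close> as an
  intersection of powers \<open>P\<^sup>d\<close>, and \<open>I\<close> has a minimal primary component inside each of the primes \<open>P\<close>.
\<close>

lemma symbolic_power_subset_power:
  fixes I :: "('n::finite, 'k::field) mpoly set"
  assumes "is_ideal I" "k \<ge> 1" "intersection_type (ideal_power I k)"
    and f: "f \<in> ideal_power I k" "m \<in> Poly_Mapping.keys f" "mono_degree m \<le> t"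
  shows "symbolic_power I t \<subseteq> ideal_power I k"
proof -
  obtain \<F> where "\<forall>(P, d)\<in>\<F>. monomial_prime_ideal P \<and> d \<ge> 1"
    and Ik: "ideal_power I k = (\<Inter>(P, d)\<in>\<F>. ideal_power P d)"
    using assms(3) unfolding intersection_type_def by (elim exE conjE) rule
  then have F: "monomial_prime_ideal P \<and> d \<ge> 1" if "(P, d) \<in> \<F>" for P d
    using that by auto
  have "symbolic_power I t \<subseteq> ideal_power P d" if Pd: "(P, d) \<in> \<F>" for P d
  proof -
    have P: "monomial_prime_ideal P" "d \<ge> 1" using F[OF Pd] by auto
    then have prime: "is_prime_ideal P" and idP: "is_ideal P"
      by (auto simp: monomial_prime_ideal_def is_prime_ideal_iff)
    have le: "ideal_power I k \<subseteq> ideal_power P d" unfolding Ik using Pd by (rule INF_lower2) simp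
    then have "f \<in> order_ideal d" using f(1) monomial_prime_power_order[OF P(1)] by blast
    then have dt: "d \<le> t" using f(2,3) by (auto simp: order_ideal_def)
    have "ideal_power P d \<subseteq> P"
      using ideal_power_antimono[OF idP P(2)] ideal_power_1[OF idP] by simp
    have "I \<subseteq> P"
    proof
      fix x assume "x \<in> I"
      then have "x ^ k \<in> P" using power_in_ideal_power le \<open>ideal_power P d \<subseteq> P\<close> by blast
      then show "x \<in> P" using assms(2)
      proof (induction k)
        case (Suc k)
        then show ?case using prime by (cases k) (auto simp: is_prime_ideal_iff)
      qed simp
    qed
    with minimal_primary_component_below_prime[OF noetherian_polynomial_ring assms(1) prime]
    obtain Q where Q: "Q \<in> minimal_primary_components I" "Q \<subseteq> P" by blast
    have "symbolic_power I t \<subseteq> ideal_power Q t" using Q(1) by (auto simp: symbolic_power_def)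
    also have "\<dots> \<subseteq> ideal_power P t" using idP Q(2) by (rule ideal_power_mono)
    also have "\<dots> \<subseteq> ideal_power P d" using idP dt by (rule ideal_power_antimono)
    finally show ?thesis .
  qed
  then show ?thesis unfolding Ik by auto
qed

section \<open>Existence of minimal graded free resolutions\<close>

text \<open>
  The part of \<open>f\<close> whose multiple of a basis element of degree \<open>s\<close> has degree \<open>t\<close>. It is \<open>0\<close> when \<open>t < s\<close>,
  so no truncated subtraction enters.
\<close>

definition component :: "nat \<Rightarrow> nat \<Rightarrow> ('n::finite, 'k::field) mpoly \<Rightarrow> ('n, 'k) mpoly" where
  "component s t f =
     (\<Sum>m | m \<in> Poly_Mapping.keys f \<and> mono_degree m + s = t. Poly_Mapping.single m (Poly_Mapping.lookup f m))"

lemma lookup_component: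
  "Poly_Mapping.lookup (component s t f) m = (if mono_degree m + s = t then Poly_Mapping.lookup f m else 0)"
proof -
  have fin: "finite {m \<in> Poly_Mapping.keys f. mono_degree m + s = t}" by simp
  have "Poly_Mapping.lookup (component s t f) m =
      (\<Sum>m'\<in>{m \<in> Poly_Mapping.keys f. mono_degree m + s = t}. if m' = m then Poly_Mapping.lookup f m else 0)"
    unfolding component_def lookup_sum by (intro sum.cong) (auto simp: lookup_single when_def)
  then show ?thesis using fin by (simp add: sum.delta in_keys_iff)
qed

lemma component_add: "component s t (f + g) = component s t f + component s t g"
  by (rule poly_mapping_eqI) (simp add: lookup_component lookup_add)

lemma component_zero [simp]: "component s t 0 = 0"
  by (rule poly_mapping_eqI) (simp add: lookup_component)

lemma component_sum: "component s t (sum f A) = (\<Sum>a\<in>A. component s t (f a))"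
  by (induction A rule: infinite_finite_induct) (simp_all add: component_add)

lemma component_times_homogeneous:
  assumes g: "\<And>m. m \<in> Poly_Mapping.keys g \<Longrightarrow> mono_degree m + s = s'"
  shows "component s t (f * g) = component s' t f * g"
proof -
  define f1 where "f1 = component s' t f"
  define f2 where "f2 = f - f1"
  have f1: "mono_degree m + s' = t" if "m \<in> Poly_Mapping.keys f1" for m
    using that by (auto simp: f1_def in_keys_iff lookup_component split: if_splits)
  have f2: "mono_degree m + s' \<noteq> t" if "m \<in> Poly_Mapping.keys f2" for m
    using that by (auto simp: f2_def f1_def in_keys_iff lookup_component lookup_minus split: if_splits)
  have "mono_degree m + s = t" if "m \<in> Poly_Mapping.keys (f1 * g)" for m
  proof -
    from that keys_mult[of f1 g] obtain a b where "m = a + b" "a \<in> Poly_Mapping.keys f1" "b \<in> Poly_Mapping.keys g"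
      by blast
    with f1[of a] g[of b] show ?thesis by (simp add: mono_degree_add)
  qed
  then have 1: "component s t (f1 * g) = f1 * g"
    by (intro poly_mapping_eqI) (auto simp: lookup_component in_keys_iff)
  have "mono_degree m + s \<noteq> t" if "m \<in> Poly_Mapping.keys (f2 * g)" for m
  proof -
    from that keys_mult[of f2 g] obtain a b where "m = a + b" "a \<in> Poly_Mapping.keys f2" "b \<in> Poly_Mapping.keys g"
      by blast
    with f2[of a] g[of b] show ?thesis by (auto simp: mono_degree_add)
  qed
  then have 2: "component s t (f2 * g) = 0"
    by (intro poly_mapping_eqI) (auto simp: lookup_component in_keys_iff)
  have "f * g = f1 * g + f2 * g" by (simp add: f2_def algebra_simps)
  then have "component s t (f * g) = f1 * g" by (simp add: component_add 1 2)
  then show ?thesis by (simp add: f1_def)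
qed

text \<open>
  Submodules of \<open>\<Oplus>\<^sub>p S(- s p)\<close>, \<open>p < r\<close>, that contain the homogeneous components of their elements.
\<close>

definition graded_submodule ::
    "nat \<Rightarrow> (nat \<Rightarrow> nat) \<Rightarrow> (nat \<Rightarrow> ('n::finite, 'k::field) mpoly) set \<Rightarrow> bool" where
  "graded_submodule r s Z \<longleftrightarrow> vec.subspace Z \<and> (\<forall>v\<in>Z. \<forall>p\<ge>r. v p = 0) \<and>
     (\<forall>v\<in>Z. \<forall>t. (\<lambda>p. component (s p) t (v p)) \<in> Z)"

definition homogeneous_vector ::
    "nat \<Rightarrow> (nat \<Rightarrow> nat) \<Rightarrow> nat \<Rightarrow> (nat \<Rightarrow> ('n::finite, 'k::field) mpoly) \<Rightarrow> bool" where
  "homogeneous_vector r s t v \<longleftrightarrow> (\<forall>p<r. \<forall>m\<in>Poly_Mapping.keys (v p). mono_degree m + s p = t)"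

definition combination ::
    "nat \<Rightarrow> (nat \<Rightarrow> nat \<Rightarrow> 'a::comm_ring_1) \<Rightarrow> (nat \<Rightarrow> 'a) \<Rightarrow> nat \<Rightarrow> 'a" where
  "combination k g w = (\<lambda>p. \<Sum>q<k. w q * g q p)"

definition syzygies :: "nat \<Rightarrow> (nat \<Rightarrow> nat \<Rightarrow> 'a::comm_ring_1) \<Rightarrow> (nat \<Rightarrow> 'a) set" where
  "syzygies k g = {w. (\<forall>q\<ge>k. w q = 0) \<and> combination k g w = 0}"

text \<open>
  One step of a minimal resolution: \<open>g\<close> lists homogeneous generators of \<open>Z\<close> of degrees \<open>s'\<close>, and every
  homogeneous relation among them has coefficients in the irrelevant maximal ideal.
\<close>

definition minimal_presentation ::
    "nat \<Rightarrow> (nat \<Rightarrow> nat) \<Rightarrow> (nat \<Rightarrow> ('n::finite, 'k::field) mpoly) set \<Rightarrow>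
     nat \<Rightarrow> (nat \<Rightarrow> nat) \<Rightarrow> (nat \<Rightarrow> nat \<Rightarrow> ('n, 'k) mpoly) \<Rightarrow> bool" where
  "minimal_presentation r s Z k s' g \<longleftrightarrow>
     graded_submodule r s Z \<and> (\<forall>q<k. homogeneous_vector r s (s' q) (g q)) \<and> Z = range (combination k g) \<and>
     (\<forall>w\<in>syzygies k g. \<forall>t. homogeneous_vector k s' t w \<longrightarrow> (\<forall>q<k. Poly_Mapping.lookup (w q) 0 = 0))"

lemma graded_submodule_homogeneous_generators:
  fixes Z :: "(nat \<Rightarrow> ('n::finite, 'k::field) mpoly) set"
  assumes "graded_submodule r s Z"
  shows "vec.span {v \<in> Z. \<exists>t. homogeneous_vector r s t v} = Z"
proof (rule vec.span_subspace)
  show "vec.subspace Z" using assms by (simp add: graded_submodule_def)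
  show "Z \<subseteq> vec.span {v \<in> Z. \<exists>t. homogeneous_vector r s t v}"
  proof
    fix v assume v: "v \<in> Z"
    define T where "T = (\<Union>p<r. (\<lambda>m. mono_degree m + s p) ` Poly_Mapping.keys (v p))"
    have fin: "finite T" by (auto simp: T_def)
    have "v = (\<Sum>t\<in>T. (\<lambda>p. component (s p) t (v p)))"
    proof
      fix p
      have "Poly_Mapping.lookup (v p) m = (\<Sum>t\<in>T. Poly_Mapping.lookup (component (s p) t (v p)) m)" for m
      proof (cases "m \<in> Poly_Mapping.keys (v p)")
        case True
        then have "p < r" using assms v by (cases "p < r") (auto simp: graded_submodule_def)
        with True have "mono_degree m + s p \<in> T" by (auto simp: T_def)
        then show ?thesis using fin by (simp add: lookup_component sum.delta)
      qed (simp add: lookup_component in_keys_iff cong: if_cong)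
      then show "v p = (\<Sum>t\<in>T. (\<lambda>p. component (s p) t (v p))) p"
        by (intro poly_mapping_eqI) (simp add: sum_fun_apply lookup_sum)
    qed
    also have "\<dots> \<in> vec.span {v \<in> Z. \<exists>t. homogeneous_vector r s t v}"
    proof (intro vec.span_sum vec.span_base CollectI conjI exI)
      fix t
      show "(\<lambda>p. component (s p) t (v p)) \<in> Z" using assms v by (simp add: graded_submodule_def)
      show "homogeneous_vector r s t (\<lambda>p. component (s p) t (v p))"
        by (auto simp: homogeneous_vector_def in_keys_iff lookup_component split: if_splits)
    qed
    finally show "v \<in> vec.span {v \<in> Z. \<exists>t. homogeneous_vector r s t v}" .
  qed
qed auto

lemma graded_submodule_syzygies:
  assumes "graded_submodule r s Z" "\<And>q. q < k \<Longrightarrow> g q \<in> Z" "\<And>q. q < k \<Longrightarrow> homogeneous_vector r s (s' q) (g q)"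
  shows "graded_submodule k s' (syzygies k g)"
  unfolding graded_submodule_def
proof (intro conjI ballI allI impI)
  show "vec.subspace (syzygies k g)"
  proof (rule vec.subspaceI)
    show "0 \<in> syzygies k g" by (simp add: syzygies_def combination_def fun_eq_iff)
  next
    fix x y assume xy: "x \<in> syzygies k g" "y \<in> syzygies k g"
    have "combination k g (x + y) = combination k g x + combination k g y"
      by (simp add: combination_def fun_eq_iff distrib_right sum.distrib)
    with xy show "x + y \<in> syzygies k g" by (simp add: syzygies_def)
  next
    fix c x assume x: "x \<in> syzygies k g"
    have "combination k g (vscale c x) = vscale c (combination k g x)"
      by (simp add: combination_def fun_eq_iff sum_distrib_left mult.assoc)
    with x show "vscale c x \<in> syzygies k g" by (simp add: syzygies_def fun_eq_iff)
  qed
  show "w q = 0" if "w \<in> syzygies k g" "k \<le> q" for w q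
    using that by (simp add: syzygies_def)
  fix w t assume w: "w \<in> syzygies k g"
  have "combination k g (\<lambda>q. component (s' q) t (w q)) p = 0" for p
  proof (cases "p < r")
    case True
    have "combination k g (\<lambda>q. component (s' q) t (w q)) p = (\<Sum>q<k. component (s p) t (w q * g q p))"
      unfolding combination_def
      by (intro sum.cong refl component_times_homogeneous[symmetric])
        (use assms(3) True in \<open>auto simp: homogeneous_vector_def\<close>)
    also have "\<dots> = component (s p) t (combination k g w p)"
      by (simp add: combination_def component_sum)
    also have "\<dots> = 0" using w by (simp add: syzygies_def)
    finally show ?thesis .
  next
    case False
    then have "g q p = 0" if "q < k" for q using assms(1,2) that by (auto simp: graded_submodule_def)
    then show ?thesis by (simp add: combination_def)
  qed
  then show "(\<lambda>q. component (s' q) t (w q)) \<in> syzygies k g"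
    using w by (auto simp: syzygies_def)
qed

text \<open>
  Take homogeneous generators, as few as possible. In a homogeneous relation a coefficient with a nonzero
  constant term is a constant for degree reasons, hence a unit, and the generator that it multiplies
  could be omitted.
\<close>

lemma minimal_presentation_exists:
  fixes Z :: "(nat \<Rightarrow> ('n::finite, 'k::field) mpoly) set"
  assumes Z: "graded_submodule r s Z"
  shows "\<exists>k s' g. minimal_presentation r s Z k s' g"
proof -
  define H where "H = {v \<in> Z. \<exists>t. homogeneous_vector r s t v}"
  have spanH: "vec.span H = Z"
    unfolding H_def using Z by (rule graded_submodule_homogeneous_generators)
  obtain B where B: "finite B" "vec.span B = Z"
    using hilbert_basis_free_module[of Z r] Z by (auto simp: graded_submodule_def)
  define gens where "gens = (\<lambda>G. G \<subseteq> H \<and> finite G \<and> vec.span G = Z)"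
  have "\<exists>G. gens G"
    unfolding gens_def using vec.finite_spanning_subset[of B H] B spanH by auto
  then obtain G where "gens G" and min: "\<And>G'. gens G' \<Longrightarrow> card G \<le> card G'"
    using ex_has_least_nat[of gens _ card] by metis
  then have GH: "G \<subseteq> H" and fin: "finite G" and spanG: "vec.span G = Z"
    by (auto simp: gens_def)
  obtain g where g: "bij_betw g {..<card G} G"
    using ex_bij_betw_nat_finite[OF fin] by (auto simp: atLeast0LessThan)
  define k where "k = card G"
  have gG: "g q \<in> G" if "q < k" for q using g that by (auto simp: k_def bij_betw_def)
  have "\<exists>t. homogeneous_vector r s t (g q)" if "q < k" for q
    using gG[OF that] GH by (auto simp: H_def)
  then obtain s' where s': "\<And>q. q < k \<Longrightarrow> homogeneous_vector r s (s' q) (g q)" by metis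
  have comb: "combination k g w = (\<Sum>q<k. vscale (w q) (g q))" for w
    by (simp add: fun_eq_iff combination_def sum_fun_apply)
  have "Z = range (combination k g)"
  proof (intro equalityI subsetI)
    fix v assume "v \<in> Z"
    then obtain u where "v = (\<Sum>x\<in>G. vscale (u x) x)"
      using spanG vec.span_finite[OF fin] by auto
    also have "\<dots> = (\<Sum>q<k. vscale (u (g q)) (g q))"
      using sum.reindex_bij_betw[OF g, of "\<lambda>x. vscale (u x) x"] by (simp add: k_def)
    also have "\<dots> = combination k g (\<lambda>q. u (g q))" by (simp add: comb)
    finally show "v \<in> range (combination k g)" by blast
  next
    fix v assume "v \<in> range (combination k g)"
    then obtain w where "v = combination k g w" by blast
    then show "v \<in> Z"
      unfolding comb spanG[symmetric] using gG by (auto intro: vec.span_sum[OF vec.span_scale[OF vec.span_base]])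
  qed
  moreover have "Poly_Mapping.lookup (w q) 0 = 0"
    if w: "w \<in> syzygies k g" "homogeneous_vector k s' t w" and q: "q < k" for w t q
  proof (rule ccontr)
    assume nz: "Poly_Mapping.lookup (w q) 0 \<noteq> 0"
    define c where "c = Poly_Mapping.lookup (w q) 0"
    have "0 \<in> Poly_Mapping.keys (w q)" using nz by (simp add: in_keys_iff)
    then have t: "t = s' q" using w(2) q by (force simp: homogeneous_vector_def)
    have "m = 0" if "m \<in> Poly_Mapping.keys (w q)" for m
    proof -
      have "mono_degree m = 0" using w(2) q that t by (auto simp: homogeneous_vector_def)
      then show "m = 0" by (intro poly_mapping_eqI) (simp add: mono_degree_def)
    qed
    then have wq: "w q = Poly_Mapping.single 0 c"
      by (intro poly_mapping_eqI) (auto simp: lookup_single when_def c_def in_keys_iff)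
    define y where "y = (\<Sum>q'\<in>{..<k} - {q}. vscale (w q') (g q'))"
    have rel0: "vscale (w q) (g q) + y = 0"
      using w(1) q sum.remove[of "{..<k}" q "\<lambda>q'. vscale (w q') (g q')"]
      by (simp add: syzygies_def comb y_def)
    have rel: "w q * g q p + y p = 0" for p
      using fun_cong[OF rel0, of p] by simp
    have inv: "Poly_Mapping.single 0 (- inverse c) * w q = - 1"
      unfolding wq mult_single using nz by (simp add: c_def single_uminus)
    have "g q p = Poly_Mapping.single 0 (- inverse c) * y p" for p
    proof -
      have "0 = Poly_Mapping.single 0 (- inverse c) * (w q * g q p + y p)" by (simp only: rel mult_zero_right)
      also have "\<dots> = (Poly_Mapping.single 0 (- inverse c) * w q) * g q p + Poly_Mapping.single 0 (- inverse c) * y p"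
        by (simp only: distrib_left mult.assoc)
      finally show ?thesis by (simp add: inv)
    qed
    then have "g q = vscale (Poly_Mapping.single 0 (- inverse c)) y" by (simp add: fun_eq_iff)
    moreover have "y \<in> vec.span (G - {g q})"
      unfolding y_def
    proof (intro vec.span_sum vec.span_scale vec.span_base)
      fix q' assume "q' \<in> {..<k} - {q}"
      then show "g q' \<in> G - {g q}"
        using g q gG[of q'] by (auto simp: bij_betw_def inj_on_def k_def)
    qed
    ultimately have "g q \<in> vec.span (G - {g q})" by (metis vec.span_scale)
    then have "G \<subseteq> vec.span (G - {g q})" using vec.span_superset[of "G - {g q}"] by auto
    then have "vec.span (G - {g q}) = Z"
      unfolding spanG[symmetric] using vec.span_mono[of "G - {g q}" G]
      by (auto simp: vec.span_eq vec.span_base)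
    then have "gens (G - {g q})" using GH fin by (auto simp: gens_def)
    then show False using min[of "G - {g q}"] card_Diff1_less[OF fin gG[OF q]] by simp
  qed
  ultimately have "minimal_presentation r s Z k s' g"
    using Z s' by (auto simp: minimal_presentation_def)
  then show ?thesis by blast
qed

lemma minimal_presentation_generator:
  assumes "minimal_presentation r s Z k s' g" "q < k"
  shows "g q \<in> Z"
proof -
  have "combination k g (\<lambda>q'. if q' = q then 1 else 0) = g q"
  proof
    fix p
    have "combination k g (\<lambda>q'. if q' = q then 1 else 0) p = (\<Sum>q'<k. if q' = q then g q p else 0)"
      unfolding combination_def by (intro sum.cong) auto
    then show "combination k g (\<lambda>q'. if q' = q then 1 else 0) p = g q p"
      using assms(2) by (simp add: sum.delta)
  qed
  then show ?thesis using assms(1) by (metis minimal_presentation_def rangeI)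
qed

definition truncate_vector :: "nat \<Rightarrow> (nat \<Rightarrow> 'a::zero) \<Rightarrow> nat \<Rightarrow> 'a" where
  "truncate_vector r v = (\<lambda>p. if p < r then v p else 0)"

text \<open>
  The values of a vector beyond the rank are irrelevant for a complex but not for membership in a submodule;
  truncation translates between the two.
\<close>

lemma truncate_in_presented:
  assumes "minimal_presentation r s Z k s' g"
  shows "truncate_vector r v \<in> Z \<longleftrightarrow> (\<exists>w. \<forall>p<r. v p = combination k g w p)"
proof
  assume "truncate_vector r v \<in> Z"
  then obtain w where "truncate_vector r v = combination k g w"
    using assms by (auto simp: minimal_presentation_def)
  then have "v p = combination k g w p" if "p < r" for p
    using that by (auto simp: truncate_vector_def dest: fun_cong[of _ _ p])
  then show "\<exists>w. \<forall>p<r. v p = combination k g w p" by blast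
next
  assume "\<exists>w. \<forall>p<r. v p = combination k g w p"
  then obtain w where w: "\<And>p. p < r \<Longrightarrow> v p = combination k g w p" by blast
  have Z: "combination k g w \<in> Z" using assms by (auto simp: minimal_presentation_def)
  then have "combination k g w p = 0" if "p \<ge> r" for p
    using that assms by (auto simp: minimal_presentation_def graded_submodule_def)
  then have "truncate_vector r v = combination k g w"
    using w by (auto simp: truncate_vector_def fun_eq_iff)
  with Z show "truncate_vector r v \<in> Z" by simp
qed

lemma truncate_in_syzygies:
  assumes "minimal_presentation r s Z k s' g"
  shows "truncate_vector k w \<in> syzygies k g \<longleftrightarrow> (\<forall>p<r. combination k g w p = 0)"
proof -
  have "combination k g (truncate_vector k w) = combination k g w"
    by (auto simp: combination_def truncate_vector_def fun_eq_iff)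
  moreover have "combination k g w p = 0" if "p \<ge> r" for p
    using that assms by (auto simp: minimal_presentation_def graded_submodule_def)
  ultimately show ?thesis
    by (auto simp: syzygies_def fun_eq_iff truncate_vector_def) (metis not_le)
qed

text \<open>
  Iterate: present the ideal minimally, then the module of syzygies of the generators, and so on. The
  columns of each differential are syzygies of the preceding generators, so minimality of the preceding
  step puts their entries into the irrelevant maximal ideal.
\<close>

theorem minimal_graded_free_resolution_exists:
  fixes J :: "('n::finite, 'k::field) mpoly set"
  assumes J: "is_ideal J" and gr: "\<And>f t. f \<in> J \<Longrightarrow> component 0 t f \<in> J"
  shows "\<exists>F. minimal_graded_free_resolution J F"
proof -
  define Z0 where "Z0 = as_vector ` J"
  have sub: "idl.subspace J" using J by (simp add: is_ideal_iff_subspace)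
  have Z0: "graded_submodule 1 (\<lambda>_. 0) Z0"
    unfolding graded_submodule_def
  proof (intro conjI ballI allI impI)
    show "vec.subspace Z0" unfolding Z0_def using sub by (rule subspace_image_as_vector)
    show "v p = 0" if "v \<in> Z0" "1 \<le> p" for v p using that by (auto simp: Z0_def as_vector_def)
    fix v t assume "v \<in> Z0"
    then obtain f where "v = as_vector f" "f \<in> J" by (auto simp: Z0_def)
    then show "(\<lambda>p. component 0 t (v p)) \<in> Z0"
      using gr by (auto simp: Z0_def as_vector_def fun_eq_iff intro!: image_eqI[of _ _ "component 0 t f"])
  qed
  define P where "P = (\<lambda>(n::nat) (r, s, Z :: (nat \<Rightarrow> ('n, 'k) mpoly) set, k, s', g).
    minimal_presentation r s Z k s' g \<and> (n = 0 \<longrightarrow> r = 1 \<and> s = (\<lambda>_. 0) \<and> Z = Z0))"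
  define Q where "Q = (\<lambda>(n::nat) (r :: nat, s :: nat \<Rightarrow> nat, Z :: (nat \<Rightarrow> ('n, 'k) mpoly) set, k :: nat, s' :: nat \<Rightarrow> nat, g :: nat \<Rightarrow> nat \<Rightarrow> ('n, 'k) mpoly)
    (r2, s2, Z2, k2 :: nat, s2' :: nat \<Rightarrow> nat, g2 :: nat \<Rightarrow> nat \<Rightarrow> ('n, 'k) mpoly).
    r2 = k \<and> s2 = s' \<and> Z2 = syzygies k g)"
  have "\<exists>f. \<forall>n. P n (f n) \<and> Q n (f n) (f (Suc n))"
  proof (rule dependent_nat_choice)
    show "\<exists>x. P 0 x"
      using minimal_presentation_exists[OF Z0] by (auto simp: P_def)
    fix x n assume "P n x"
    then obtain r s Z k s' g where x: "x = (r, s, Z, k, s', g)" and mp: "minimal_presentation r s Z k s' g"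
      by (auto simp: P_def split: prod.splits)
    have "graded_submodule k s' (syzygies k g)"
      using mp minimal_presentation_generator[OF mp]
      by (intro graded_submodule_syzygies[of r s Z]) (auto simp: minimal_presentation_def)
    from minimal_presentation_exists[OF this]
    show "\<exists>y. P (Suc n) y \<and> Q n x y"
      by (auto simp: P_def Q_def x)
  qed
  then obtain f where f: "\<And>n. P n (f n)" "\<And>n. Q n (f n) (f (Suc n))" by blast
  define r s Z k s' g where "r n = fst (f n)" and "s n = fst (snd (f n))" and "Z n = fst (snd (snd (f n)))"
    and "k n = fst (snd (snd (snd (f n))))" and "s' n = fst (snd (snd (snd (snd (f n)))))"
    and "g n = snd (snd (snd (snd (snd (f n)))))" for n
  then have fn: "f n = (r n, s n, Z n, k n, s' n, g n)" for n by simp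
  have mp: "minimal_presentation (r n) (s n) (Z n) (k n) (s' n) (g n)" for n
    using f(1)[of n] by (simp add: P_def fn)
  have start: "r 0 = 1" "s 0 = (\<lambda>_. 0)" "Z 0 = Z0" using f(1)[of 0] by (simp_all add: P_def fn)
  have next': "r (Suc n) = k n" "s (Suc n) = s' n" "Z (Suc n) = syzygies (k n) (g n)" for n
    using f(2)[of n] by (simp_all add: Q_def fn)
  define F where "F = \<lparr>rank = k, shift = s', aug = (\<lambda>p. g 0 p 0), bd = (\<lambda>i. g (Suc i))\<rparr>"
  have F: "rank F = k" "shift F = s'" "aug F p = g 0 p 0" "bd F i = g (Suc i)" for i p
    by (simp_all add: F_def)
  have apply_aug: "apply_aug F v = combination (k 0) (g 0) v 0" for v
    by (simp add: apply_aug_def combination_def F)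
  have apply_bd: "apply_bd F i v = combination (k (Suc i)) (g (Suc i)) v" for i v
    by (simp add: apply_bd_def combination_def F fun_eq_iff)
  have exact: "(\<forall>p<r i. combination (k i) (g i) v p = 0) \<longleftrightarrow>
      (\<exists>w. \<forall>q<k i. v q = combination (k (Suc i)) (g (Suc i)) w q)" for i v
    using truncate_in_syzygies[OF mp[of i], of v] truncate_in_presented[OF mp[of "Suc i"], of v]
    by (simp add: next')
  have hom: "mono_degree m + s n p = s' n q" if "q < k n" "p < r n" "m \<in> Poly_Mapping.keys (g n q p)" for n p q m
    using mp[of n] that by (auto simp: minimal_presentation_def homogeneous_vector_def)
  have "graded_free_resolution J F"
    unfolding graded_free_resolution_def
  proof (intro conjI allI impI ballI)
    show "homogeneous (shift F 0 p) (aug F p)" if "p < rank F 0" for p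
      using hom[of p 0 0] that by (auto simp: F start homogeneous_def)
    show "mono_degree m + shift F i p = shift F (Suc i) q"
      if "q < rank F (Suc i)" "p < rank F i" "m \<in> Poly_Mapping.keys (bd F i q p)" for i q p m
      using hom[of q "Suc i" p m] that by (simp add: F next')
    show "range (apply_aug F) = J"
    proof -
      have "as_vector ` J = range (combination (k 0) (g 0))"
        using mp[of 0] by (simp add: minimal_presentation_def start Z0_def)
      then have "(\<lambda>v. v 0) ` as_vector ` J = (\<lambda>v. v 0) ` range (combination (k 0) (g 0))" by simp
      then show ?thesis by (simp add: image_image as_vector_def apply_aug)
    qed
    show "apply_aug F v = 0 \<longleftrightarrow> (\<exists>w. \<forall>p<rank F 0. v p = apply_bd F 0 w p)" for v
      using exact[of 0 v] by (simp add: start apply_aug apply_bd F)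
    show "(\<forall>p<rank F i. apply_bd F i v p = 0) \<longleftrightarrow>
        (\<exists>w. \<forall>q<rank F (Suc i). v q = apply_bd F (Suc i) w q)" for i v
      using exact[of "Suc i" v] by (simp add: next' apply_bd F)
  qed
  moreover have "Poly_Mapping.lookup (bd F i q p) 0 = 0" if "q < rank F (Suc i)" "p < rank F i" for i q p
  proof -
    have q: "q < k (Suc i)" and p: "p < k i" using that by (simp_all add: F)
    have "g (Suc i) q \<in> syzygies (k i) (g i)"
      using minimal_presentation_generator[OF mp q] by (simp add: next')
    moreover have "homogeneous_vector (k i) (s' i) (s' (Suc i) q) (g (Suc i) q)"
      using mp[of "Suc i"] q by (simp add: minimal_presentation_def next')
    ultimately show ?thesis using mp[of i] p unfolding minimal_presentation_def F by blast
  qed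
  ultimately show ?thesis unfolding minimal_graded_free_resolution_def by blast
qed

section \<open>Finiteness of the Betti table\<close>

definition variable_ideal :: "'n set \<Rightarrow> ('n::finite, 'k::field) mpoly set" where
  "variable_ideal A = {f. \<forall>m\<in>Poly_Mapping.keys f. \<exists>i\<in>A. Poly_Mapping.lookup m i \<noteq> 0}"

lemma subspace_variable_ideal: "idl.subspace (variable_ideal A :: ('n::finite, 'k::field) mpoly set)"
proof (rule idl.subspaceI)
  show "0 \<in> (variable_ideal A :: ('n, 'k) mpoly set)" by (simp add: variable_ideal_def)
  show "x + y \<in> variable_ideal A" if "x \<in> variable_ideal A" "y \<in> variable_ideal A" for x y :: "('n, 'k) mpoly"
    using that keys_add[of x y] by (auto simp: variable_ideal_def)
  fix c x :: "('n, 'k) mpoly" assume x: "x \<in> variable_ideal A"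
  show "c * x \<in> variable_ideal A"
    unfolding variable_ideal_def
  proof (intro CollectI ballI)
    fix m assume "m \<in> Poly_Mapping.keys (c * x)"
    then obtain a b where "m = a + b" "b \<in> Poly_Mapping.keys x" using keys_mult[of c x] by blast
    with x show "\<exists>i\<in>A. Poly_Mapping.lookup m i \<noteq> 0" by (auto simp: variable_ideal_def lookup_add)
  qed
qed

lemma variable_ideal_empty: "variable_ideal {} = {0}"
  by (auto simp: variable_ideal_def simp flip: keys_eq_empty)

lemma in_variable_ideal_UNIV: "f \<in> variable_ideal UNIV \<longleftrightarrow> Poly_Mapping.lookup f 0 = 0"
proof -
  have "(\<exists>i. Poly_Mapping.lookup m i \<noteq> 0) \<longleftrightarrow> m \<noteq> 0" for m :: "'a \<Rightarrow>\<^sub>0 nat"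
    by (auto intro: poly_mapping_eqI)
  then show ?thesis by (auto simp: variable_ideal_def in_keys_iff)
qed

lemma variable_ideal_mono: "A \<subseteq> B \<Longrightarrow> variable_ideal A \<subseteq> variable_ideal B"
  unfolding variable_ideal_def by blast

lemma poly_var_in_variable_ideal: "i \<in> A \<Longrightarrow> poly_var i \<in> variable_ideal A"
  by (auto simp: variable_ideal_def poly_var_def intro!: bexI[of _ i])

lemma variable_nonzerodivisor:
  assumes "x \<notin> A" "poly_var x * f \<in> variable_ideal A"
  shows "f \<in> variable_ideal A"
  unfolding variable_ideal_def
proof (intro CollectI ballI)
  fix m assume m: "m \<in> Poly_Mapping.keys f"
  have "Poly_Mapping.lookup (poly_var x * f) (Poly_Mapping.single x 1 + m) = Poly_Mapping.lookup f m"
    by (simp add: poly_var_def lookup_single_times)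
  with m have "Poly_Mapping.single x 1 + m \<in> Poly_Mapping.keys (poly_var x * f)" by (simp add: in_keys_iff)
  with assms obtain i where "i \<in> A" "Poly_Mapping.lookup (Poly_Mapping.single x 1 + m) i \<noteq> 0"
    unfolding variable_ideal_def by blast
  with assms(1) show "\<exists>i\<in>A. Poly_Mapping.lookup m i \<noteq> 0"
    by (auto simp: lookup_add lookup_single when_def split: if_splits)
qed

lemma variable_ideal_insert:
  assumes f: "f \<in> variable_ideal (insert x A)"
  shows "\<exists>w a. f = poly_var x * w + a \<and> a \<in> variable_ideal A"
proof -
  define S where "S = {m \<in> Poly_Mapping.keys f. Poly_Mapping.lookup m x \<noteq> 0}"
  define w where "w = (\<Sum>m\<in>S. Poly_Mapping.single (m - Poly_Mapping.single x 1) (Poly_Mapping.lookup f m))"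
  have "poly_var x * w = (\<Sum>m\<in>S. Poly_Mapping.single m (Poly_Mapping.lookup f m))"
    unfolding w_def sum_distrib_left
  proof (intro sum.cong refl)
    fix m assume "m \<in> S"
    then have "Poly_Mapping.single x 1 + (m - Poly_Mapping.single x 1) = m"
      by (intro poly_mapping_eqI) (auto simp: S_def lookup_add lookup_minus lookup_single when_def)
    then show "poly_var x * Poly_Mapping.single (m - Poly_Mapping.single x 1) (Poly_Mapping.lookup f m)
        = Poly_Mapping.single m (Poly_Mapping.lookup f m)"
      by (simp add: poly_var_def mult_single)
  qed
  moreover have "Poly_Mapping.lookup (\<Sum>m\<in>S. Poly_Mapping.single m (Poly_Mapping.lookup f m)) m =
      (if m \<in> S then Poly_Mapping.lookup f m else 0)" for m
  proof -
    have "Poly_Mapping.lookup (\<Sum>m\<in>S. Poly_Mapping.single m (Poly_Mapping.lookup f m)) m =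
        (\<Sum>m'\<in>S. if m' = m then Poly_Mapping.lookup f m else 0)"
      unfolding lookup_sum by (intro sum.cong) (auto simp: lookup_single when_def)
    then show ?thesis by (simp add: S_def sum.delta)
  qed
  ultimately have w: "Poly_Mapping.lookup (poly_var x * w) m = (if m \<in> S then Poly_Mapping.lookup f m else 0)" for m
    by simp
  have "f - poly_var x * w \<in> variable_ideal A"
    unfolding variable_ideal_def
  proof (intro CollectI ballI)
    fix m assume "m \<in> Poly_Mapping.keys (f - poly_var x * w)"
    then have "m \<in> Poly_Mapping.keys f" "m \<notin> S"
      by (auto simp: in_keys_iff lookup_minus w split: if_splits)
    with f show "\<exists>i\<in>A. Poly_Mapping.lookup m i \<noteq> 0" by (auto simp: variable_ideal_def S_def)
  qed
  then show ?thesis by (intro exI[of _ w] exI[of _ "f - poly_var x * w"]) simp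
qed

lemma apply_bd_add: "apply_bd F i (\<lambda>q. v q + w q) p = apply_bd F i v p + apply_bd F i w p"
  by (simp add: apply_bd_def distrib_right sum.distrib)

lemma apply_bd_diff: "apply_bd F i (\<lambda>q. v q - w q) p = apply_bd F i v p - apply_bd F i w p"
  by (simp add: apply_bd_def left_diff_distrib sum_subtractf)

lemma apply_bd_scale: "apply_bd F i (\<lambda>q. c * v q) p = c * apply_bd F i v p"
  by (simp add: apply_bd_def sum_distrib_left mult.assoc)

lemma apply_bd_cong: "(\<And>q. q < rank F (Suc i) \<Longrightarrow> v q = w q) \<Longrightarrow> apply_bd F i v p = apply_bd F i w p"
  by (simp add: apply_bd_def)

lemma apply_bd_in_ideal:
  assumes "idl.subspace V" "\<And>q. q < rank F (Suc i) \<Longrightarrow> v q \<in> V"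
  shows "apply_bd F i v p \<in> V"
  unfolding apply_bd_def
proof (rule idl.subspace_sum[OF assms(1)])
  fix q assume "q \<in> {..<rank F (Suc i)}"
  then have "bd F i q p * v q \<in> V" using assms by (intro idl.subspace_scale) auto
  then show "v q * bd F i q p \<in> V" by (simp add: mult.commute)
qed

text \<open>
  Reducing an exact complex of free modules modulo a nonzerodivisor costs exactness in one homological
  degree only. For a variable \<open>x\<close> outside \<open>A\<close>: if the differential of \<open>v\<close> is \<open>x w\<close> modulo \<open>A\<close>, then \<open>w\<close>
  is a cycle modulo \<open>A\<close> because \<open>x\<close> can be cancelled there. So \<open>w\<close> is the boundary of some \<open>w'\<close>
  modulo \<open>A\<close>, and \<open>v - x w'\<close> is a cycle modulo \<open>A\<close>, hence a boundary modulo \<open>A\<close>.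
\<close>

lemma resolution_exact_modulo_variables:
  fixes F :: "('n::finite, 'k::field) free_complex"
  assumes F: "graded_free_resolution J F" and "finite A"
    and "card A \<le> i" "\<And>p. p < rank F i \<Longrightarrow> apply_bd F i v p \<in> variable_ideal A"
  shows "\<exists>w. \<forall>q<rank F (Suc i). v q - apply_bd F (Suc i) w q \<in> variable_ideal A"
  using assms(2-)
proof (induction A arbitrary: i v)
  case empty
  have ex: "\<And>i v. (\<forall>p<rank F i. apply_bd F i v p = 0) \<longleftrightarrow>
      (\<exists>w. \<forall>q<rank F (Suc i). v q = apply_bd F (Suc i) w q)"
    using F by (auto simp: graded_free_resolution_def)
  from empty obtain w where "\<forall>q<rank F (Suc i). v q = apply_bd F (Suc i) w q"
    using ex[of i v] by (auto simp: variable_ideal_empty)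
  then show ?case by (auto simp: variable_ideal_empty)
next
  case (insert x A)
  note V = subspace_variable_ideal[of A]
  obtain j where i: "i = Suc j" "card A \<le> j"
    using insert.prems(1) insert.hyps by (cases i) auto
  have "\<forall>p. \<exists>w a. p < rank F i \<longrightarrow> apply_bd F i v p = poly_var x * w + a \<and> a \<in> variable_ideal A"
    using insert.prems(2) variable_ideal_insert by blast
  then obtain w a where wa: "\<And>p. p < rank F i \<Longrightarrow> apply_bd F i v p = poly_var x * w p + a p"
    and a: "\<And>p. p < rank F i \<Longrightarrow> a p \<in> variable_ideal A" by metis
  have "apply_bd F j w p \<in> variable_ideal A" if p: "p < rank F j" for p
  proof -
    have "apply_bd F j (apply_bd F i v) p = 0"
      using F p unfolding i(1) graded_free_resolution_def by blast
    moreover have "apply_bd F j (apply_bd F i v) p = apply_bd F j (\<lambda>q. poly_var x * w q + a q) p"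
      by (rule apply_bd_cong) (simp add: wa i(1)[symmetric])
    ultimately have "poly_var x * apply_bd F j w p = - apply_bd F j a p"
      by (simp add: apply_bd_add apply_bd_scale eq_neg_iff_add_eq_0)
    moreover have "apply_bd F j a p \<in> variable_ideal A"
      by (rule apply_bd_in_ideal[OF V]) (simp add: a i(1))
    ultimately show ?thesis
      using idl.subspace_neg[OF V] variable_nonzerodivisor[OF insert.hyps(2)] by metis
  qed
  then obtain w' where w': "\<And>q. q < rank F i \<Longrightarrow> w q - apply_bd F i w' q \<in> variable_ideal A"
    using insert.IH[OF i(2), of w] unfolding i(1) by blast
  have "apply_bd F i (\<lambda>q. v q - poly_var x * w' q) p \<in> variable_ideal A" if p: "p < rank F i" for p
  proof -
    have "apply_bd F i (\<lambda>q. v q - poly_var x * w' q) p = poly_var x * (w p - apply_bd F i w' p) + a p"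
      by (simp add: apply_bd_diff apply_bd_scale wa[OF p] algebra_simps)
    also have "\<dots> \<in> variable_ideal A"
      by (intro idl.subspace_add[OF V] idl.subspace_scale[OF V] w' a p)
    finally show ?thesis .
  qed
  then obtain u where u: "\<And>q. q < rank F (Suc i) \<Longrightarrow>
      v q - poly_var x * w' q - apply_bd F (Suc i) u q \<in> variable_ideal A"
    using insert.IH[of i "\<lambda>q. v q - poly_var x * w' q"] i by auto
  have "v q - apply_bd F (Suc i) u q \<in> variable_ideal (insert x A)" if q: "q < rank F (Suc i)" for q
  proof -
    note V' = subspace_variable_ideal[of "insert x A"]
    have "w' q * poly_var x \<in> variable_ideal (insert x A)"
      by (intro idl.subspace_scale[OF V'] poly_var_in_variable_ideal) simp
    moreover have "v q - poly_var x * w' q - apply_bd F (Suc i) u q \<in> variable_ideal (insert x A)"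
      using u[OF q] variable_ideal_mono[of A "insert x A"] by blast
    ultimately have "w' q * poly_var x + (v q - poly_var x * w' q - apply_bd F (Suc i) u q)
        \<in> variable_ideal (insert x A)"
      by (rule idl.subspace_add[OF V'])
    then show ?thesis by (simp add: algebra_simps)
  qed
  then show ?case by blast
qed

text \<open>
  Modulo all the variables a minimal resolution has zero differentials but is still exact in high
  homological degrees, so its modules vanish there.
\<close>

theorem hilbert_syzygy:
  fixes F :: "('n::finite, 'k::field) free_complex"
  assumes F: "minimal_graded_free_resolution J F" and i: "card (UNIV :: 'n set) \<le> i"
  shows "rank F (Suc i) = 0"
proof (rule ccontr)
  assume nz: "rank F (Suc i) \<noteq> 0"
  let ?m = "variable_ideal UNIV :: ('n, 'k) mpoly set"
  note V = subspace_variable_ideal[of "UNIV :: 'n set", where 'k = 'k]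
  have bd: "apply_bd F i v p \<in> ?m" if "p < rank F i" for v p i
    unfolding apply_bd_def using F that
    by (intro idl.subspace_sum[OF V] idl.subspace_scale[OF V])
      (auto simp: minimal_graded_free_resolution_def in_variable_ideal_UNIV)
  obtain w where "1 - apply_bd F (Suc i) w 0 \<in> ?m"
    using resolution_exact_modulo_variables[of J F UNIV i "\<lambda>_. 1"] F i bd nz
    by (auto simp: minimal_graded_free_resolution_def)
  moreover have "apply_bd F (Suc i) w 0 \<in> ?m" using bd nz by simp
  ultimately have "1 - apply_bd F (Suc i) w 0 + apply_bd F (Suc i) w 0 \<in> ?m"
    by (rule idl.subspace_add[OF V])
  then show False by (simp add: in_variable_ideal_UNIV)
qed

lemma apply_aug_unit:
  assumes "p < rank F 0"
  shows "apply_aug F (\<lambda>q. if q = p then 1 else 0) = aug F p"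
proof -
  have "apply_aug F (\<lambda>q. if q = p then 1 else 0) = (\<Sum>q<rank F 0. if q = p then aug F p else 0)"
    unfolding apply_aug_def by (intro sum.cong) auto
  then show ?thesis using assms by (simp add: sum.delta)
qed

text \<open>
  The regularity is at least the degree of a generator of \<open>J\<close>, which is the contribution of homological
  degree \<open>0\<close> to the maximum. The syzygy theorem makes the set of which the maximum is taken finite.
\<close>

theorem element_degree_le_regularity:
  fixes J :: "('n::finite, 'k::field) mpoly set"
  assumes J: "is_ideal J" "\<And>f t. f \<in> J \<Longrightarrow> component 0 t f \<in> J" and nz: "J \<noteq> {0}"
  shows "\<exists>f\<in>J. \<exists>m\<in>Poly_Mapping.keys f. int (mono_degree m) \<le> regularity J"
proof -
  define F where "F = (SOME F. minimal_graded_free_resolution J F)"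
  have F: "minimal_graded_free_resolution J F"
    unfolding F_def using minimal_graded_free_resolution_exists[OF J] by (rule someI_ex)
  then have res: "graded_free_resolution J F" by (simp add: minimal_graded_free_resolution_def)
  have betti: "graded_betti J i j = card {p. p < rank F i \<and> shift F i p = j}" for i j
    by (simp add: graded_betti_def F_def Let_def)
  let ?n = "card (UNIV :: 'n set)"
  let ?R = "{int j - int i | i j. graded_betti J i j \<noteq> 0}"
  have "?R \<subseteq> (\<Union>i\<in>{..?n}. (\<lambda>p. int (shift F i p) - int i) ` {..<rank F i})"
  proof
    fix x assume "x \<in> ?R"
    then obtain i j where x: "x = int j - int i" "graded_betti J i j \<noteq> 0" by blast
    then have "{p. p < rank F i \<and> shift F i p = j} \<noteq> {}" unfolding betti by (metis card.empty)
    then obtain p where p: "p < rank F i" "shift F i p = j" by blast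
    have "i \<le> ?n"
    proof (rule ccontr)
      assume "\<not> i \<le> ?n"
      then obtain i' where "i = Suc i'" "?n \<le> i'" by (cases i) auto
      then show False using hilbert_syzygy[OF F] p(1) by simp
    qed
    with x(1) p show "x \<in> (\<Union>i\<in>{..?n}. (\<lambda>p. int (shift F i p) - int i) ` {..<rank F i})" by blast
  qed
  then have fin: "finite ?R" by (rule finite_subset) auto
  have "\<exists>p<rank F 0. aug F p \<noteq> 0"
  proof (rule ccontr)
    assume "\<not> ?thesis"
    then have "apply_aug F v = 0" for v by (simp add: apply_aug_def)
    then have "J = {0}" using res by (auto simp: graded_free_resolution_def)
    with nz show False ..
  qed
  then obtain p where p: "p < rank F 0" "aug F p \<noteq> 0" by blast
  then obtain m where m: "m \<in> Poly_Mapping.keys (aug F p)" using keys_eq_empty by blast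
  have deg: "mono_degree m = shift F 0 p"
    using res p(1) m by (auto simp: graded_free_resolution_def homogeneous_def)
  have "p \<in> {p'. p' < rank F 0 \<and> shift F 0 p' = shift F 0 p}" using p by simp
  then have "graded_betti J 0 (shift F 0 p) \<noteq> 0" unfolding betti by (auto simp: card_eq_0_iff)
  then have "int (shift F 0 p) - int 0 \<in> ?R" by blast
  then have "int (mono_degree m) \<le> regularity J"
    unfolding regularity_def using Max_ge[OF fin] deg by simp
  moreover have "aug F p \<in> J"
    using res unfolding apply_aug_unit[OF p(1), symmetric] graded_free_resolution_def by blast
  ultimately show ?thesis using m by blast
qed

section \<open>Monomial ideals and degrees of generators\<close>

lemma monomial_ideal_keys:
  fixes I :: "('n::finite, 'k::field) mpoly set"
  assumes I: "monomial_ideal I" and f: "f \<in> I" "m \<in> Poly_Mapping.keys f"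
  shows "Poly_Mapping.single m 1 \<in> I"
proof -
  obtain M :: "('n \<Rightarrow>\<^sub>0 nat) set" where M: "I = ideal_gen ((\<lambda>m. Poly_Mapping.single m 1) ` M)"
    using I by (auto simp: monomial_ideal_def)
  define K where "K = {f :: ('n, 'k) mpoly. \<forall>m\<in>Poly_Mapping.keys f. Poly_Mapping.single m (1::'k) \<in> I}"
  have sub: "idl.subspace I" by (simp add: M ideal_gen_eq_span)
  have "I \<subseteq> K"
    unfolding M ideal_gen_eq_span
  proof (rule idl.span_minimal)
    show "(\<lambda>m. Poly_Mapping.single m 1) ` M \<subseteq> K"
      by (auto simp: K_def M ideal_gen_eq_span intro: idl.span_base)
    show "idl.subspace K"
    proof (rule idl.subspaceI)
      show "0 \<in> K" by (simp add: K_def)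
      show "x + y \<in> K" if "x \<in> K" "y \<in> K" for x y
        using that keys_add[of x y] by (auto simp: K_def)
      fix c x assume x: "x \<in> K"
      show "c * x \<in> K"
        unfolding K_def
      proof (intro CollectI ballI)
        fix m assume "m \<in> Poly_Mapping.keys (c * x)"
        then obtain a b where ab: "m = a + b" "b \<in> Poly_Mapping.keys x" using keys_mult[of c x] by blast
        have "Poly_Mapping.single a 1 * Poly_Mapping.single b (1::'k) \<in> I"
          using x ab(2) by (intro idl.subspace_scale[OF sub]) (simp add: K_def)
        then show "Poly_Mapping.single m 1 \<in> I" by (simp add: ab(1) mult_single)
      qed
    qed
  qed
  with f show ?thesis by (auto simp: K_def)
qed

lemma is_ideal_monomial_ideal: "monomial_ideal I \<Longrightarrow> is_ideal I"
  by (auto simp: monomial_ideal_def is_ideal_ideal_gen)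

lemma single_power:
  "\<exists>m'. Poly_Mapping.single m (1::'k::field) ^ k = Poly_Mapping.single m' 1 \<and> mono_degree m' = k * mono_degree m"
proof (induction k)
  case 0
  show ?case by (intro exI[of _ 0]) simp
next
  case (Suc k)
  then obtain m' where "Poly_Mapping.single m (1::'k) ^ k = Poly_Mapping.single m' 1" "mono_degree m' = k * mono_degree m"
    by blast
  then show ?case by (intro exI[of _ "m + m'"]) (simp add: mult_single mono_degree_add)
qed

lemma monomial_power_in_ideal_power:
  fixes I :: "('n::finite, 'k::field) mpoly set"
  assumes "monomial_ideal I" "f \<in> I" "m \<in> Poly_Mapping.keys f"
  shows "\<exists>m'. Poly_Mapping.single m' 1 \<in> ideal_power I k \<and> mono_degree m' = k * mono_degree m"
  using power_in_ideal_power[OF monomial_ideal_keys[OF assms], of k] single_power[of m k, where 'k = 'k]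
  by metis

text \<open>
  Expanding the second factor into homogeneous components reduces the claim to
  \<open>component_times_homogeneous\<close>.
\<close>

lemma component_in_product:
  fixes I J :: "('n::finite, 'k::field) mpoly set"
  assumes "is_ideal I" "is_ideal J"
    and I: "\<And>f t. f \<in> I \<Longrightarrow> component 0 t f \<in> I" and J: "\<And>f t. f \<in> J \<Longrightarrow> component 0 t f \<in> J"
    and f: "f \<in> ideal_mult I J"
  shows "component 0 t f \<in> ideal_mult I J"
proof -
  have sub: "idl.subspace (ideal_mult I J)"
    using is_ideal_mult[OF assms(1,2)] by (simp add: is_ideal_iff_subspace)
  from f show ?thesis
  proof induction
    case (prod i j)
    define T where "T = mono_degree ` Poly_Mapping.keys j"
    have fin: "finite T" by (simp add: T_def)
    have "j = (\<Sum>d\<in>T. component 0 d j)"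
      by (rule poly_mapping_eqI) (auto simp: lookup_sum lookup_component sum.delta fin T_def in_keys_iff)
    then have "i * j = (\<Sum>d\<in>T. i * component 0 d j)" by (metis sum_distrib_left)
    then have "component 0 t (i * j) = (\<Sum>d\<in>T. component 0 t (i * component 0 d j))"
      by (simp add: component_sum)
    also have "\<dots> = (\<Sum>d\<in>T. component d t i * component 0 d j)"
      by (intro sum.cong refl component_times_homogeneous)
        (auto simp: in_keys_iff lookup_component split: if_splits)
    also have "\<dots> \<in> ideal_mult I J"
    proof (intro idl.subspace_sum[OF sub] ideal_mult_I J prod)
      fix d
      have "component d t i = (if d \<le> t then component 0 (t - d) i else 0)"
        by (rule poly_mapping_eqI) (auto simp: lookup_component)
      then show "component d t i \<in> I"
        using I[OF prod(1)] assms(1) by (auto simp: is_ideal_iff_subspace idl.subspace_0)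
    qed
    finally show ?case by simp
  next
    case (sum f g)
    then show ?case using idl.subspace_add[OF sub] by (simp add: component_add)
  qed
qed

lemma component_in_monomial_ideal:
  assumes "monomial_ideal I" "f \<in> I"
  shows "component 0 t f \<in> I"
proof -
  have sub: "idl.subspace I" using is_ideal_monomial_ideal[OF assms(1)] by (simp add: is_ideal_iff_subspace)
  have "Poly_Mapping.single m (Poly_Mapping.lookup f m) \<in> I" if "m \<in> Poly_Mapping.keys f" for m
    using idl.subspace_scale[OF sub monomial_ideal_keys[OF assms that], of "Poly_Mapping.single 0 (Poly_Mapping.lookup f m)"]
    by (simp add: mult_single)
  then show ?thesis unfolding component_def by (intro idl.subspace_sum[OF sub]) auto
qed

lemma component_in_monomial_power:
  assumes "monomial_ideal I" "f \<in> ideal_power I k"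
  shows "component 0 t f \<in> ideal_power I k"
  using assms(2)
proof (induction k arbitrary: f t)
  case (Suc k)
  note id = is_ideal_monomial_ideal[OF assms(1)]
  from Suc show ?case
    unfolding ideal_power_Suc
    by (intro component_in_product is_ideal_power id component_in_monomial_ideal[OF assms(1)])
qed simp

lemma minimal_homogeneous_generators_exist:
  assumes "graded_ideal J"
  shows "\<exists>G. minimal_homogeneous_generators J G"
proof -
  obtain H where H: "\<And>g. g \<in> H \<Longrightarrow> \<exists>d. homogeneous d g" "J = ideal_gen H"
    using assms by (auto simp: graded_ideal_def)
  define gens where "gens = (\<lambda>G. G \<subseteq> H \<and> finite G \<and> ideal_gen G = J)"
  have "\<exists>G. gens G" unfolding gens_def H(2) using finite_generating_subset by blast
  then obtain G where G: "gens G" and min: "\<And>G'. gens G' \<Longrightarrow> card G \<le> card G'"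
    using ex_has_least_nat[of gens _ card] by metis
  have "ideal_gen G' \<noteq> J" if "G' \<subset> G" for G'
  proof
    assume "ideal_gen G' = J"
    then have "gens G'" using G that by (auto simp: gens_def intro: finite_subset)
    then have "card G \<le> card G'" by (rule min)
    moreover have "card G' < card G" using G that by (auto simp: gens_def intro: psubset_card_mono)
    ultimately show False by simp
  qed
  then have "minimal_homogeneous_generators J G"
    using G H(1) by (auto simp: minimal_homogeneous_generators_def gens_def)
  then show ?thesis ..
qed

text \<open>
  By the basis theorem the arbitrary choice of minimal generators in \<open>theta\<close> is one from a nonempty set,
  and some generator is nonzero since \<open>J\<close> is.
\<close>

lemma monomial_of_degree_le_theta:
  assumes "graded_ideal J" "J \<noteq> {0}"
  shows "\<exists>f\<in>J. \<exists>m\<in>Poly_Mapping.keys f. mono_degree m \<le> theta J"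
proof -
  define G where "G = (SOME G. minimal_homogeneous_generators J G)"
  have "minimal_homogeneous_generators J G"
    unfolding G_def using minimal_homogeneous_generators_exist[OF assms(1)] by (rule someI_ex)
  then have fin: "finite G" and J: "J = idl.span G"
    by (auto simp: minimal_homogeneous_generators_def ideal_gen_eq_span)
  have "\<not> G \<subseteq> {0}"
    using assms(2) idl.span_minimal[of G "{0}"] idl.span_zero[of G] by (auto simp: J)
  then obtain g where g: "g \<in> G" "g \<noteq> 0" by blast
  then obtain m where m: "m \<in> Poly_Mapping.keys g" using keys_eq_empty by blast
  have "mono_degree m \<le> poly_degree g" unfolding poly_degree_def using m by simp
  also have "\<dots> \<le> theta J" unfolding theta_def G_def[symmetric] using fin g(1) by simp
  finally show ?thesis using m g(1) by (auto simp: J intro: idl.span_base)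
qed

lemma is_reduction_refl:
  assumes "is_ideal I"
  shows "is_reduction I I"
proof -
  have "ideal_power I 2 = ideal_mult I (ideal_power I (2 - 1))"
    using assms by (simp add: numeral_2_eq_2 ideal_mult_UNIV_left)
  then show ?thesis unfolding is_reduction_def using assms by blast
qed

lemma graded_monomial_ideal:
  fixes I :: "('n::finite, 'k::field) mpoly set"
  assumes "monomial_ideal I"
  shows "graded_ideal I"
proof -
  obtain M :: "('n \<Rightarrow>\<^sub>0 nat) set" where M: "I = ideal_gen ((\<lambda>m. Poly_Mapping.single m 1) ` M)"
    using assms unfolding monomial_ideal_def by blast
  have "\<exists>d. homogeneous d g" if g: "g \<in> (\<lambda>m. Poly_Mapping.single m (1::'k)) ` M" for g
  proof -
    obtain m where "g = Poly_Mapping.single m 1" using g by blast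
    then have "homogeneous (mono_degree m) g" by (simp add: homogeneous_def)
    then show ?thesis ..
  qed
  with M show ?thesis unfolding graded_ideal_def by blast
qed

lemma zero_not_reduction:
  fixes I :: "('n::finite, 'k::field) mpoly set"
  assumes "monomial_ideal I" "I \<noteq> {0}" "is_reduction J I"
  shows "J \<noteq> {0}"
proof
  assume J: "J = {0}"
  obtain k where k: "ideal_power I k = ideal_mult J (ideal_power I (k - 1))"
    using assms(3) by (auto simp: is_reduction_def)
  have "ideal_power I k \<subseteq> {0}" unfolding k J by (rule ideal_mult_subset) (auto simp: is_ideal_iff_subspace)
  moreover have "0 \<in> I" using is_ideal_monomial_ideal[OF assms(1)] by (simp add: is_ideal_iff_subspace idl.subspace_0)
  then obtain f where "f \<in> I" "f \<noteq> 0" using assms(2) by blast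
  then obtain m where "f \<in> I" "m \<in> Poly_Mapping.keys f" using keys_eq_empty by blast
  from monomial_power_in_ideal_power[OF assms(1) this, of k]
  obtain m' where "Poly_Mapping.single m' 1 \<in> ideal_power I k" by blast
  ultimately have "Poly_Mapping.single m' 1 = (0 :: ('n, 'k) mpoly)" by blast
  from arg_cong[OF this, of "\<lambda>f. Poly_Mapping.lookup f m'"] show False by simp
qed

theorem theorem3p4:
  fixes I :: "('n::finite, 'k::field) mpoly set"
  assumes "monomial_ideal I" and "I \<noteq> {0}"
  shows "(\<forall>k\<ge>1. intersection_type (ideal_power I k) \<longrightarrow>
            symbolic_power I (nat (regularity (ideal_power I k))) \<subseteq> ideal_power I k)
    \<and> ((\<forall>\<^sub>F k in sequentially. intersection_type (ideal_power I k)) \<longrightarrow>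
         (\<forall>\<^sub>F k in sequentially. symbolic_power I ((rho I + 1) * k) \<subseteq> ideal_power I k)
         \<and> rho I + 1 \<le> theta I + 1
         \<and> ((\<forall>\<^sub>F k in sequentially. has_linear_resolution (ideal_power I k)) \<longrightarrow>
              (\<forall>\<^sub>F k in sequentially. symbolic_power I (theta I * k) \<subseteq> ideal_power I k)))"
proof -
  have id: "is_ideal I" using assms(1) by (rule is_ideal_monomial_ideal)
  have "0 \<in> I" using id by (simp add: is_ideal_iff_subspace idl.subspace_0)
  then obtain f where "f \<in> I" "f \<noteq> 0" using assms(2) by blast
  then obtain m where fm: "f \<in> I" "m \<in> Poly_Mapping.keys f" using keys_eq_empty by blast
  have nz: "ideal_power I k \<noteq> {0}" for k
  proof
    obtain m' where m': "Poly_Mapping.single m' 1 \<in> ideal_power I k"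
      using monomial_power_in_ideal_power[OF assms(1) fm] by blast
    assume "ideal_power I k = {0}"
    with m' have "Poly_Mapping.single m' (1::'k) = 0" by blast
    from arg_cong[OF this, of "\<lambda>f. Poly_Mapping.lookup f m'"] show False by simp
  qed
  have a: "symbolic_power I (nat (regularity (ideal_power I k))) \<subseteq> ideal_power I k"
    if k: "k \<ge> 1" "intersection_type (ideal_power I k)" for k
  proof -
    obtain g l where "g \<in> ideal_power I k" "l \<in> Poly_Mapping.keys g"
      "int (mono_degree l) \<le> regularity (ideal_power I k)"
      using element_degree_le_regularity[OF is_ideal_power[OF id] component_in_monomial_power[OF assms(1)] nz]
      by blast
    then show ?thesis by (intro symbolic_power_subset_power[OF id k]) auto
  qed
  have b: "\<forall>\<^sub>F k in sequentially. symbolic_power I (d * k) \<subseteq> ideal_power I k"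
    if ev: "\<forall>\<^sub>F k in sequentially. intersection_type (ideal_power I k)"
      and d: "f \<in> I" "m \<in> Poly_Mapping.keys f" "mono_degree m \<le> d" for d f m
    using ev eventually_ge_at_top[of 1]
  proof eventually_elim
    case (elim k)
    obtain m' where m': "Poly_Mapping.single m' 1 \<in> ideal_power I k" "mono_degree m' = k * mono_degree m"
      using monomial_power_in_ideal_power[OF assms(1) d(1,2)] by blast
    show ?case
      by (rule symbolic_power_subset_power[OF id elim(2,1) m'(1), of m']) (use d(3) m'(2) in auto)
  qed
  have gr: "graded_ideal I" using assms(1) by (rule graded_monomial_ideal)
  have red: "\<exists>J. graded_ideal J \<and> is_reduction J I \<and> theta J = theta I"
    using gr is_reduction_refl[OF id] by blast
  then have rho_le: "rho I \<le> theta I" unfolding rho_def by (rule Least_le)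
  obtain J where J: "graded_ideal J" "is_reduction J I" "theta J = rho I"
    using LeastI[of "\<lambda>d. \<exists>J. graded_ideal J \<and> is_reduction J I \<and> theta J = d", OF red]
    unfolding rho_def by blast
  obtain g l where g: "g \<in> J" "l \<in> Poly_Mapping.keys g" "mono_degree l \<le> rho I"
    using monomial_of_degree_le_theta[OF J(1) zero_not_reduction[OF assms J(2)]] J(3) by auto
  then have gI: "g \<in> I" using J(2) by (auto simp: is_reduction_def)
  show ?thesis
  proof (intro conjI impI allI)
    show "symbolic_power I (nat (regularity (ideal_power I k))) \<subseteq> ideal_power I k"
      if "1 \<le> k" "intersection_type (ideal_power I k)" for k
      using that by (rule a)
    show "rho I + 1 \<le> theta I + 1" using rho_le by simp
    assume "\<forall>\<^sub>F k in sequentially. intersection_type (ideal_power I k)"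
    note b' = b[OF this gI g(2)]
    show "\<forall>\<^sub>F k in sequentially. symbolic_power I ((rho I + 1) * k) \<subseteq> ideal_power I k"
      using g(3) by (intro b') simp
    show "\<forall>\<^sub>F k in sequentially. symbolic_power I (theta I * k) \<subseteq> ideal_power I k"
      using g(3) rho_le by (intro b') simp
  qed
qed

end
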